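(* Assume that the steady background flow is everywhere tangential to the boundary, $n\cdot u_0=0$ on $\partial\Omega$. For every $\delta\rho_{\mathrm I}\in L^2(\Omega)$ there exists $w_{\mathrm I}\in L^2(\Omega)^d$ such that $$\nabla\cdot(\rho_0w_{\mathrm I})=-\delta\rho_{\mathrm I}\quad\text{in }\Omega$$ (in the sense of distributions), that is, such that $h_{\mathrm I}:=\rho_0^{-1}(\delta\rho_{\mathrm I}+\nabla\cdot(\rho_0w_{\mathrm I}))=0$. Moreover, for $h_{\mathrm I}\in L^2(\Omega)$, the mild solution $h\in C([0,\tau];L^2(\Omega))$ of the initial value problem $$\rho_0D_0h=0\ \text{ in }\Omega,\ t\in(0,\tau),\qquad h=h_{\mathrm I}\ \text{ in }\Omega\text{ at }t=0,$$ vanishes identically (the "no resonance" assumption, for $h=\rho_0^{-1}(\delta\rho+\nabla\cdot(\rho_0w))$) if and only if $h_{\mathrm I}=0$. Hence the "no resonance" assumption can be enforced by choosing the initial datum $w_{\mathrm I}$ of the Lagrangian displacement $w$, with no restriction on the initial datum $\delta\rho_{\mathrm I}\in L^2(\Omega)$ of $\delta\rho$.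
   Context: $\Omega\subset\mathbb R^d$ is open, bounded, connected, and lies locally on one side of its Lipschitz boundary $\partial\Omega$, with outward unit normal $n$; $0<\tau<\infty$. The background flow (velocity $u_0$, density $\rho_0$, pressure $p_0$, volume force density $\varphi_0$, speed of sound $c_0$) is steady, Lipschitz continuous on $\bar\Omega$, satisfies Euler's equations, in particular mass conservation $\nabla\cdot(\rho_0u_0)=0$, and $\inf_{\bar\Omega}\rho_0>0$, $\inf_{\bar\Omega}c_0>0$. $D_0=\partial_t+u_0\cdot\nabla$. $\delta\rho$ is the Eulerian density perturbation (a solution component of the linearized Euler's equations) and $w$ the Lagrangian displacement; $\delta\rho_{\mathrm I},w_{\mathrm I}$ are their initial data. The "no resonance" assumption is the implication $\rho_0D_0h=0\Rightarrow h=0$ for the quantity $h=\rho_0^{-1}(\delta\rho+\nabla\cdot(\rho_0w))$. Mild solution: $h(t)=S(t)h_{\mathrm I}$, where $(S(t))_{t\ge0}$ is the contraction $C_0$-semigroup on $L^2_{\rho_0}(\Omega)$ ($L^2(\Omega)$ with inner product $\int_\Omega\rho_0\,\cdot\,\cdot$) generated by $-u_0\cdot\nabla$ with domain $\{h\in L^2(\Omega)\mid u_0\cdot\nabla h\in L^2(\Omega)\}$ (no boundary condition is needed since $n\cdot u_0=0$ on $\partial\Omega$). *)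

theory Defs
  imports "HOL-Analysis.Analysis"
begin

section \<open>Lipschitz domains and outward unit normals\<close>

text \<open>In the chart \<open>U\<close> the domain is the part of \<open>U\<close> strictly above the graph of a Lipschitz
  function \<open>\<gamma>\<close> over the hyperplane orthogonal to the unit vector \<open>e\<close>; hence the boundary in \<open>U\<close> is
  the graph and the domain lies on one side of it.\<close>

definition boundary_chart ::
  "'a::euclidean_space set \<Rightarrow> 'a \<Rightarrow> ('a \<Rightarrow> real) \<Rightarrow> 'a set \<Rightarrow> bool" where
  "boundary_chart \<Omega> e \<gamma> U \<longleftrightarrow>
     norm e = 1 \<and> (\<exists>L. L-lipschitz_on {y. y \<bullet> e = 0} \<gamma>) \<and> open U \<and>
     \<Omega> \<inter> U = {x \<in> U. \<gamma> (x - (x \<bullet> e) *\<^sub>R e) < x \<bullet> e}"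

definition lipschitz_domain :: "'a::euclidean_space set \<Rightarrow> bool" where
  "lipschitz_domain \<Omega> \<longleftrightarrow>
     open \<Omega> \<and> bounded \<Omega> \<and> connected \<Omega> \<and>
     (\<forall>p \<in> frontier \<Omega>. \<exists>e \<gamma> U. p \<in> U \<and> boundary_chart \<Omega> e \<gamma> U)"

text \<open>Locally the domain is the set where \<open>x \<mapsto> \<gamma> (x - (x \<bullet> e) e) - x \<bullet> e\<close> is negative. The outward
  normal is the normalized gradient of this function; it exists at the boundary points where \<open>\<gamma>\<close> is
  differentiable, that is, almost everywhere on the boundary.\<close>

definition outward_unit_normal :: "'a::euclidean_space set \<Rightarrow> 'a \<Rightarrow> 'a \<Rightarrow> bool" where
  "outward_unit_normal \<Omega> p \<nu> \<longleftrightarrow>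
     p \<in> frontier \<Omega> \<and>
     (\<exists>e \<gamma> U g. p \<in> U \<and> boundary_chart \<Omega> e \<gamma> U \<and>
        (GDERIV (\<lambda>x. \<gamma> (x - (x \<bullet> e) *\<^sub>R e) - x \<bullet> e) p :> g) \<and> \<nu> = g /\<^sub>R norm g)"

text \<open>For continuous \<open>u\<close>, vanishing of \<open>n \<bullet> u\<close> almost everywhere on the boundary is the same as
  vanishing at every boundary point that has a normal.\<close>

definition tangential :: "'a::euclidean_space set \<Rightarrow> ('a \<Rightarrow> 'a) \<Rightarrow> bool" where
  "tangential \<Omega> u \<longleftrightarrow> (\<forall>p \<in> frontier \<Omega>. \<forall>\<nu>. outward_unit_normal \<Omega> p \<nu> \<longrightarrow> \<nu> \<bullet> u p = 0)"


section \<open>The background flow\<close>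

text \<open>Lipschitz functions are differentiable almost everywhere (Rademacher), with classical
  derivatives equal to the distributional ones; for them the following operators are used
  almost everywhere only.\<close>

definition grad :: "('a::euclidean_space \<Rightarrow> real) \<Rightarrow> 'a \<Rightarrow> 'a" where
  "grad f x = (\<Sum>i\<in>Basis. frechet_derivative f (at x) i *\<^sub>R i)"

definition divergence :: "('a::euclidean_space \<Rightarrow> 'a) \<Rightarrow> 'a \<Rightarrow> real" where
  "divergence u x = (\<Sum>i\<in>Basis. frechet_derivative u (at x) i \<bullet> i)"

text \<open>Conservation of mass, balance of momentum with volume force density \<open>\<phi>\<close>, and the relation
  \<open>Dp/Dt = c\<^sup>2 D\<rho>/Dt\<close> that defines the speed of sound (no change of entropy along the flow),
  all for a flow that does not depend on time.\<close>

definition steady_euler ::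
  "'a::euclidean_space set \<Rightarrow> ('a \<Rightarrow> 'a) \<Rightarrow> ('a \<Rightarrow> real) \<Rightarrow> ('a \<Rightarrow> real) \<Rightarrow> ('a \<Rightarrow> 'a) \<Rightarrow> ('a \<Rightarrow> real) \<Rightarrow> bool"
  where
  "steady_euler \<Omega> u \<rho> p \<phi> c \<longleftrightarrow>
     (AE x in lebesgue_on \<Omega>.
        divergence (\<lambda>y. \<rho> y *\<^sub>R u y) x = 0 \<and>
        \<rho> x *\<^sub>R frechet_derivative u (at x) (u x) = - grad p x + \<phi> x \<and>
        u x \<bullet> grad p x = (c x)\<^sup>2 * (u x \<bullet> grad \<rho> x))"

definition background_flow ::
  "'a::euclidean_space set \<Rightarrow> ('a \<Rightarrow> 'a) \<Rightarrow> ('a \<Rightarrow> real) \<Rightarrow> ('a \<Rightarrow> real) \<Rightarrow> ('a \<Rightarrow> 'a) \<Rightarrow> ('a \<Rightarrow> real) \<Rightarrow> bool"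
  where
  "background_flow \<Omega> u \<rho> p \<phi> c \<longleftrightarrow>
     (\<exists>L. L-lipschitz_on (closure \<Omega>) u) \<and>
     (\<exists>L. L-lipschitz_on (closure \<Omega>) \<rho>) \<and>
     (\<exists>L. L-lipschitz_on (closure \<Omega>) p) \<and>
     (\<exists>L. L-lipschitz_on (closure \<Omega>) \<phi>) \<and>
     (\<exists>L. L-lipschitz_on (closure \<Omega>) c) \<and>
     steady_euler \<Omega> u \<rho> p \<phi> c \<and>
     0 < (INF x\<in>closure \<Omega>. \<rho> x) \<and>
     0 < (INF x\<in>closure \<Omega>. c x)"


section \<open>Square integrable functions\<close>

text \<open>Elements of \<open>L\<^sup>2\<close> are represented by functions; equality in \<open>L\<^sup>2\<close> is \<open>eq_ae\<close>.\<close>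

definition L2_space :: "'a::euclidean_space set \<Rightarrow> ('a \<Rightarrow> 'b::euclidean_space) set" where
  "L2_space \<Omega> = {f \<in> borel_measurable (lebesgue_on \<Omega>).
                    integrable (lebesgue_on \<Omega>) (\<lambda>x. (norm (f x))\<^sup>2)}"

definition eq_ae :: "'a::euclidean_space set \<Rightarrow> ('a \<Rightarrow> 'b) \<Rightarrow> ('a \<Rightarrow> 'b) \<Rightarrow> bool" where
  "eq_ae \<Omega> f g \<longleftrightarrow> (AE x in lebesgue_on \<Omega>. f x = g x)"

definition L2_norm :: "'a::euclidean_space set \<Rightarrow> ('a \<Rightarrow> real) \<Rightarrow> ('a \<Rightarrow> real) \<Rightarrow> real" where
  "L2_norm \<Omega> \<rho> f = sqrt (LINT x|lebesgue_on \<Omega>. \<rho> x * (f x)\<^sup>2)"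

definition continuous_L2 ::
  "'a::euclidean_space set \<Rightarrow> real \<Rightarrow> (real \<Rightarrow> 'a \<Rightarrow> real) \<Rightarrow> bool" where
  "continuous_L2 \<Omega> \<tau> h \<longleftrightarrow>
     (\<forall>t\<in>{0..\<tau>}. h t \<in> L2_space \<Omega> \<and>
        ((\<lambda>s. L2_norm \<Omega> (\<lambda>_. 1) (\<lambda>x. h s x - h t x)) \<longlongrightarrow> 0) (at t within {0..\<tau>}))"


section \<open>Distributional derivatives\<close>

primrec Ck :: "nat \<Rightarrow> ('a::euclidean_space \<Rightarrow> real) \<Rightarrow> bool" where
  "Ck 0 f \<longleftrightarrow> continuous_on UNIV f"
| "Ck (Suc k) f \<longleftrightarrow>
     f differentiable_on UNIV \<and> (\<forall>i\<in>Basis. Ck k (\<lambda>x. frechet_derivative f (at x) i))"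

definition test_function :: "'a::euclidean_space set \<Rightarrow> ('a \<Rightarrow> real) \<Rightarrow> bool" where
  "test_function \<Omega> \<psi> \<longleftrightarrow>
     (\<forall>k. Ck k \<psi>) \<and> compact (closure {x. \<psi> x \<noteq> 0}) \<and> closure {x. \<psi> x \<noteq> 0} \<subseteq> \<Omega>"

text \<open>\<open>\<nabla> \<bullet> v = q\<close> in the sense of distributions (for \<open>v\<close> and \<open>q\<close> in \<open>L\<^sup>2\<close>).\<close>

definition has_weak_divergence ::
  "'a::euclidean_space set \<Rightarrow> ('a \<Rightarrow> 'a) \<Rightarrow> ('a \<Rightarrow> real) \<Rightarrow> bool" where
  "has_weak_divergence \<Omega> v q \<longleftrightarrow>
     (\<forall>\<psi>. test_function \<Omega> \<psi> \<longrightarrow>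
        (LINT x|lebesgue_on \<Omega>. q x * \<psi> x) = - (LINT x|lebesgue_on \<Omega>. v x \<bullet> grad \<psi> x))"

text \<open>\<open>u \<bullet> \<nabla>h = g\<close> in the sense of distributions, for Lipschitz \<open>u\<close> and \<open>h\<close>, \<open>g\<close> in \<open>L\<^sup>2\<close>: the
  distribution \<open>\<Sum>\<^sub>i u\<^sub>i \<partial>\<^sub>i h\<close> maps \<open>\<psi>\<close> to \<open>- \<Sum>\<^sub>i \<integral> h \<partial>\<^sub>i (u\<^sub>i \<psi>)\<close>.\<close>

definition has_weak_advection ::
  "'a::euclidean_space set \<Rightarrow> ('a \<Rightarrow> 'a) \<Rightarrow> ('a \<Rightarrow> real) \<Rightarrow> ('a \<Rightarrow> real) \<Rightarrow> bool" where
  "has_weak_advection \<Omega> u h g \<longleftrightarrow>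
     (\<forall>\<psi>. test_function \<Omega> \<psi> \<longrightarrow>
        (LINT x|lebesgue_on \<Omega>. g x * \<psi> x) =
        - (LINT x|lebesgue_on \<Omega>. h x * divergence (\<lambda>y. \<psi> y *\<^sub>R u y) x))"


section \<open>The transport semigroup and mild solutions\<close>

definition contraction_C0_semigroup ::
  "'a::euclidean_space set \<Rightarrow> ('a \<Rightarrow> real) \<Rightarrow> (real \<Rightarrow> ('a \<Rightarrow> real) \<Rightarrow> 'a \<Rightarrow> real) \<Rightarrow> bool" where
  "contraction_C0_semigroup \<Omega> \<rho> S \<longleftrightarrow>
     (\<forall>t\<ge>0. \<forall>f\<in>L2_space \<Omega>. S t f \<in> L2_space \<Omega>) \<and>
     (\<forall>t\<ge>0. \<forall>f\<in>L2_space \<Omega>. \<forall>g\<in>L2_space \<Omega>. eq_ae \<Omega> f g \<longrightarrow> eq_ae \<Omega> (S t f) (S t g)) \<and>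
     (\<forall>t\<ge>0. \<forall>f\<in>L2_space \<Omega>. \<forall>g\<in>L2_space \<Omega>. \<forall>a b.
        eq_ae \<Omega> (S t (\<lambda>x. a * f x + b * g x)) (\<lambda>x. a * S t f x + b * S t g x)) \<and>
     (\<forall>f\<in>L2_space \<Omega>. eq_ae \<Omega> (S 0 f) f) \<and>
     (\<forall>s\<ge>0. \<forall>t\<ge>0. \<forall>f\<in>L2_space \<Omega>. eq_ae \<Omega> (S (s + t) f) (S s (S t f))) \<and>
     (\<forall>t\<ge>0. \<forall>f\<in>L2_space \<Omega>. L2_norm \<Omega> \<rho> (S t f) \<le> L2_norm \<Omega> \<rho> f) \<and>
     (\<forall>f\<in>L2_space \<Omega>. ((\<lambda>t. L2_norm \<Omega> \<rho> (\<lambda>x. S t f x - f x)) \<longlongrightarrow> 0) (at_right 0))"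

text \<open>\<open>f\<close> is in the domain of the infinitesimal generator, which maps it to \<open>g\<close>.\<close>

definition semigroup_generator ::
  "'a::euclidean_space set \<Rightarrow> ('a \<Rightarrow> real) \<Rightarrow> (real \<Rightarrow> ('a \<Rightarrow> real) \<Rightarrow> 'a \<Rightarrow> real) \<Rightarrow>
   ('a \<Rightarrow> real) \<Rightarrow> ('a \<Rightarrow> real) \<Rightarrow> bool" where
  "semigroup_generator \<Omega> \<rho> S f g \<longleftrightarrow>
     f \<in> L2_space \<Omega> \<and> g \<in> L2_space \<Omega> \<and>
     ((\<lambda>t. L2_norm \<Omega> \<rho> (\<lambda>x. (S t f x - f x) / t - g x)) \<longlongrightarrow> 0) (at_right 0)"

text \<open>The contraction semigroup generated by \<open>- u \<bullet> \<nabla>\<close> with domain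
  \<open>{f \<in> L\<^sup>2. u \<bullet> \<nabla>f \<in> L\<^sup>2}\<close>; the equivalence fixes the graph of the generator, hence its domain too.\<close>

definition transport_semigroup ::
  "'a::euclidean_space set \<Rightarrow> ('a \<Rightarrow> 'a) \<Rightarrow> ('a \<Rightarrow> real) \<Rightarrow>
   (real \<Rightarrow> ('a \<Rightarrow> real) \<Rightarrow> 'a \<Rightarrow> real) \<Rightarrow> bool" where
  "transport_semigroup \<Omega> u \<rho> S \<longleftrightarrow>
     contraction_C0_semigroup \<Omega> \<rho> S \<and>
     (\<forall>f\<in>L2_space \<Omega>. \<forall>g\<in>L2_space \<Omega>.
        semigroup_generator \<Omega> \<rho> S f g \<longleftrightarrow> has_weak_advection \<Omega> u f (\<lambda>x. - g x))"

definition mild_solution ::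
  "'a::euclidean_space set \<Rightarrow> (real \<Rightarrow> ('a \<Rightarrow> real) \<Rightarrow> 'a \<Rightarrow> real) \<Rightarrow> real \<Rightarrow>
   ('a \<Rightarrow> real) \<Rightarrow> (real \<Rightarrow> 'a \<Rightarrow> real) \<Rightarrow> bool" where
  "mild_solution \<Omega> S \<tau> h\<^sub>I h \<longleftrightarrow>
     (\<forall>t\<in>{0..\<tau>}. h t \<in> L2_space \<Omega> \<and> eq_ae \<Omega> (h t) (S t h\<^sub>I))"

definition vanishes_identically ::
  "'a::euclidean_space set \<Rightarrow> real \<Rightarrow> (real \<Rightarrow> 'a \<Rightarrow> real) \<Rightarrow> bool" where
  "vanishes_identically \<Omega> \<tau> h \<longleftrightarrow> (\<forall>t\<in>{0..\<tau>}. eq_ae \<Omega> (h t) (\<lambda>_. 0))"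


section \<open>The no resonance assumption\<close>

text \<open>\<open>h = \<rho>\<^sup>-\<^sup>1 (r + \<nabla> \<bullet> (\<rho> w))\<close>, where \<open>r\<close> is the Eulerian density perturbation, \<open>w\<close> the
  Lagrangian displacement, and the distribution \<open>\<nabla> \<bullet> (\<rho> w)\<close> is in \<open>L\<^sup>2\<close>.\<close>

definition resonance_quantity ::
  "'a::euclidean_space set \<Rightarrow> ('a \<Rightarrow> real) \<Rightarrow> ('a \<Rightarrow> real) \<Rightarrow> ('a \<Rightarrow> 'a) \<Rightarrow> ('a \<Rightarrow> real) \<Rightarrow> bool" where
  "resonance_quantity \<Omega> \<rho> r w h \<longleftrightarrow>
     (\<exists>q\<in>L2_space \<Omega>. has_weak_divergence \<Omega> (\<lambda>x. \<rho> x *\<^sub>R w x) q \<and>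
        eq_ae \<Omega> h (\<lambda>x. inverse (\<rho> x) * (r x + q x)))"

text \<open>The implication \<open>\<rho> D h = 0 \<Longrightarrow> h = 0\<close>, where the equation \<open>\<rho> D h = 0\<close> is understood in the
  mild sense.\<close>

definition no_resonance ::
  "'a::euclidean_space set \<Rightarrow> (real \<Rightarrow> ('a \<Rightarrow> real) \<Rightarrow> 'a \<Rightarrow> real) \<Rightarrow> real \<Rightarrow>
   (real \<Rightarrow> 'a \<Rightarrow> real) \<Rightarrow> bool" where
  "no_resonance \<Omega> S \<tau> h \<longleftrightarrow> (mild_solution \<Omega> S \<tau> (h 0) h \<longrightarrow> vanishes_identically \<Omega> \<tau> h)"

end

theory Submission
  imports Defs "HOL-Computational_Algebra.Polynomial"
begin

text \<open>The divergence has a right inverse on \<open>L\<^sup>2\<close> of a bounded open set that needs no boundary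
  regularity: extend \<open>q\<close> by zero and integrate it along a single coordinate direction \<open>e\<close>, so that
  \<open>v(x) = (\<integral>\<^sub>0\<^sup>R q(x - s e) ds) e\<close> with \<open>R\<close> exceeding the diameter. Translation invariance and Fubini
  move the translation onto the test function \<open>\<psi>\<close>, where the fundamental theorem of calculus gives
  \<open>\<psi>(x + R e) - \<psi>(x) = - \<psi>(x)\<close>. Division by the density, which is bounded away from zero, yields
  the displacement.

  The mild solution is the semigroup applied to its initial value, hence vanishes precisely with it.
  For the last claim the initial value of the resonance quantity has to be independent of
  representatives. This is uniqueness of the weak divergence, that is, the fundamental lemma of the
  calculus of variations, for which products of the rescaled functions \<open>exp (- 1 / (n x))\<close> give smooth
  functions converging boundedly to indicators of boxes.\<close>

section \<open>Smooth bumps on boxes\<close>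

lemma Ck_imp_continuous: "Ck k f \<Longrightarrow> continuous_on UNIV f"
  by (cases k) (auto simp: differentiable_imp_continuous_on)

lemma Ck_Suc_imp: "Ck (Suc k) f \<Longrightarrow> Ck k f"
proof (induction k arbitrary: f)
  case 0
  then show ?case by (simp add: differentiable_imp_continuous_on)
next
  case (Suc k)
  then show ?case by (metis Ck.simps(2))
qed

text \<open>Derivatives are unique, so any candidate \<open>D\<close> may stand in for
  \<open>frechet_derivative\<close> in the recursion of \<open>Ck\<close>. This is the inductive
  step of every smoothness proof below.\<close>

lemma Ck_SucI:
  assumes "\<And>x. (f has_derivative D x) (at x)" and "\<And>i. i \<in> Basis \<Longrightarrow> Ck k (\<lambda>x. D x i)"
  shows "Ck (Suc k) f"
proof -
  have "frechet_derivative f (at x) = D x" for x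
    using frechet_derivative_at[OF assms(1)] by simp
  then show ?thesis
    using assms by (auto simp: differentiable_on_def differentiable_def)
qed

lemma Ck_Suc_has_derivative:
  assumes "Ck (Suc k) f"
  shows "(f has_derivative frechet_derivative f (at x)) (at x)"
  using assms by (auto simp: differentiable_on_def frechet_derivative_works)

lemma Ck_const: "Ck k (\<lambda>_::'a::euclidean_space. c)"
proof (induction k arbitrary: c)
  case (Suc k)
  show ?case by (rule Ck_SucI[where D="\<lambda>_ _. 0"]) (auto intro: Suc)
qed auto

lemma Ck_add: "Ck k f \<Longrightarrow> Ck k g \<Longrightarrow> Ck k (\<lambda>x. f x + g x)"
proof (induction k arbitrary: f g)
  case 0
  then show ?case by (auto intro: continuous_on_add)
next
  case (Suc k)
  show ?case
  proof (rule Ck_SucI)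
    show "((\<lambda>x. f x + g x) has_derivative
        (\<lambda>i. frechet_derivative f (at x) i + frechet_derivative g (at x) i)) (at x)" for x
      by (intro has_derivative_add Ck_Suc_has_derivative[of k] Suc.prems)
  qed (use Suc in auto)
qed

lemma Ck_mult: "Ck k f \<Longrightarrow> Ck k g \<Longrightarrow> Ck k (\<lambda>x. f x * g x)"
proof (induction k arbitrary: f g)
  case 0
  then show ?case by (auto intro: continuous_on_mult)
next
  case (Suc k)
  show ?case
  proof (rule Ck_SucI)
    show "((\<lambda>x. f x * g x) has_derivative
        (\<lambda>i. f x * frechet_derivative g (at x) i + frechet_derivative f (at x) i * g x)) (at x)" for x
      by (intro has_derivative_mult Ck_Suc_has_derivative[of k] Suc.prems)
    show "Ck k (\<lambda>x. f x * frechet_derivative g (at x) i + frechet_derivative f (at x) i * g x)"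
      if "i \<in> Basis" for i
      using Suc that by (intro Ck_add Suc.IH) (auto intro: Ck_Suc_imp)
  qed
qed

lemma Ck_prod: "finite I \<Longrightarrow> (\<And>i. i \<in> I \<Longrightarrow> Ck k (f i)) \<Longrightarrow> Ck k (\<lambda>x. \<Prod>i\<in>I. f i x)"
  by (induction I rule: finite_induct) (auto intro: Ck_const Ck_mult)

text \<open>The family of these functions is closed under differentiation, which gives smoothness of
  the flat function \<open>exp (- 1 / x)\<close>.\<close>

definition flat :: "real poly \<Rightarrow> real \<Rightarrow> real" where
  "flat p x = (if 0 < x then poly p (1 / x) * exp (- (1 / x)) else 0)"

lemma poly_times_exp_neg_tendsto_0: "((\<lambda>y::real. poly p y * exp (- y)) \<longlongrightarrow> 0) at_top"
proof -
  have "((\<lambda>y. \<Sum>i\<le>degree p. coeff p i * (y ^ i / exp y)) \<longlongrightarrow> (\<Sum>i\<le>degree p. coeff p i * 0)) at_top"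
    by (intro tendsto_intros tendsto_power_div_exp_0)
  then show ?thesis
    by (simp add: poly_altdef sum_distrib_right exp_minus field_simps sum_divide_distrib)
qed

text \<open>On the right, the substitution y = 1/x turns this into the decay of p(y) exp(-y) at
  infinity; on the left the function is 0.\<close>

lemma flat_tendsto_0: "(flat p \<longlongrightarrow> 0) (at 0)"
proof -
  have "((\<lambda>x. poly p (inverse x) * exp (- inverse x)) \<longlongrightarrow> 0) (at_right 0)"
    using filterlim_compose[OF poly_times_exp_neg_tendsto_0 filterlim_inverse_at_top_right] .
  then have "(flat p \<longlongrightarrow> 0) (at_right 0)"
    by (rule Lim_transform_eventually)
      (auto simp: eventually_at_filter flat_def inverse_eq_divide)
  moreover have "(flat p \<longlongrightarrow> 0) (at_left 0)"
    by (rule tendsto_eventually) (auto simp: eventually_at_filter flat_def)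
  ultimately show ?thesis
    by (simp add: filterlim_at_split)
qed

text \<open>With y = 1/x, the chain rule gives y^2 (p(y) - p'(y)) exp(-y) for x > 0, which is again
  of the form \<open>flat\<close>; the factor \<open>[:0, 0, 1:]\<close> is the monomial
  y^2.\<close>

lemma flat_has_derivative:
  "(flat p has_real_derivative flat ([:0, 0, 1:] * (p - pderiv p)) x) (at x)"
proof (cases x "0::real" rule: linorder_cases)
  case less
  have "((\<lambda>_. 0) has_real_derivative 0) (at x)" by simp
  then have "(flat p has_real_derivative 0) (at x)"
    by (rule has_field_derivative_transform_within_open[where S="{..<0}"])
      (use less in \<open>auto simp: flat_def\<close>)
  then show ?thesis using less by (simp add: flat_def)
next
  case equal
  \<comment> \<open>Dividing by x multiplies the polynomial in 1/x by its variable, so the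
    difference quotient at 0 is \<open>flat (pCons 0 p)\<close>.\<close>
  have "((\<lambda>y. (flat p y - flat p 0) / (y - 0)) \<longlongrightarrow> 0) (at 0)"
    by (rule Lim_transform_eventually[OF flat_tendsto_0[of "pCons 0 p"]])
      (auto simp: eventually_at_filter flat_def)
  then show ?thesis using equal
    by (simp add: has_field_derivative_iff flat_def)
next
  case greater
  have "((\<lambda>x. poly p (1 / x) * exp (- (1 / x))) has_real_derivative
      flat ([:0, 0, 1:] * (p - pderiv p)) x) (at x)"
    using greater
    by (auto intro!: derivative_eq_intros DERIV_chain2[OF poly_DERIV]
        simp: flat_def field_simps power2_eq_square)
  then show ?thesis
    by (rule has_field_derivative_transform_within_open[where S="{0<..}"])
      (use greater in \<open>auto simp: flat_def\<close>)
qed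

text \<open>The induction must range over all \<open>p\<close>, since differentiation replaces
  \<open>p\<close> by another polynomial. The affine argument serves both faces of a box in each
  coordinate direction.\<close>

lemma Ck_flat_affine: "Ck k (\<lambda>x::'a::euclidean_space. flat p (x \<bullet> v + d))"
proof (induction k arbitrary: p)
  case 0
  have "continuous_on UNIV (flat p)"
    using flat_has_derivative by (auto intro!: DERIV_continuous_on)
  then have "continuous_on UNIV (\<lambda>x::'a. flat p (x \<bullet> v + d))"
    by (rule continuous_on_compose2) (auto intro!: continuous_intros)
  then show ?case by simp
next
  case (Suc k)
  let ?p = "[:0, 0, 1:] * (p - pderiv p)"
  show ?case
  proof (rule Ck_SucI)
    show "((\<lambda>x::'a. flat p (x \<bullet> v + d)) has_derivative
        (\<lambda>i. flat ?p (x \<bullet> v + d) * (i \<bullet> v))) (at x)" for x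
      by (rule has_derivative_compose[of "\<lambda>x. x \<bullet> v + d" "\<lambda>i. i \<bullet> v" x UNIV "flat p", simplified])
       (auto intro!: derivative_eq_intros
          flat_has_derivative[unfolded has_field_derivative_def, simplified])
  qed (intro Ck_mult Suc Ck_const)
qed

text \<open>Each factor is exp(-1/((n+1) d)) with d the signed distance to one face, read as 0 for d
  <= 0. The scale \<open>Suc n\<close> is positive, so every member of the sequence is positive
  exactly on the open box, and there the factors tend to 1.\<close>

definition box_bump :: "'a::euclidean_space \<Rightarrow> 'a \<Rightarrow> nat \<Rightarrow> 'a \<Rightarrow> real" where
  "box_bump a b n x =
     (\<Prod>i\<in>Basis. flat 1 (real (Suc n) * (x \<bullet> i - a \<bullet> i)) * flat 1 (real (Suc n) * (b \<bullet> i - x \<bullet> i)))"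

lemma flat_1_bounds: "0 \<le> flat 1 x" "flat 1 x \<le> 1"
  by (auto simp: flat_def)

lemma Ck_box_bump: "Ck k (box_bump a b n)"
proof -
  have "Ck k (\<lambda>x. \<Prod>i\<in>Basis. flat 1 (x \<bullet> (real (Suc n) *\<^sub>R i) + (- real (Suc n) * (a \<bullet> i))) *
      flat 1 (x \<bullet> (- real (Suc n) *\<^sub>R i) + real (Suc n) * (b \<bullet> i)))"
    by (intro Ck_prod Ck_mult Ck_flat_affine) auto
  then show ?thesis
    unfolding box_bump_def by (simp add: algebra_simps)
qed

lemma box_bump_eq_0: "x \<notin> box a b \<Longrightarrow> box_bump a b n x = 0"
  by (force simp: box_bump_def mem_box flat_def not_less mult_le_0_iff zero_less_mult_iff)

lemma box_bump_bounds: "\<bar>box_bump a b n x\<bar> \<le> 1"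
  unfolding box_bump_def abs_prod
  by (rule prod_le_1) (auto simp: abs_mult flat_1_bounds intro!: mult_le_one)

lemma box_bump_tendsto: "(\<lambda>n. box_bump a b n x) \<longlonglongrightarrow> indicator (box a b) x"
proof (cases "x \<in> box a b")
  case True
  have flat_lim: "(\<lambda>n. flat 1 (real (Suc n) * y)) \<longlonglongrightarrow> 1" if "0 < y" for y
  proof -
    have "(\<lambda>n. exp (- (inverse (real (Suc n)) / y))) \<longlonglongrightarrow> exp (- (0 / y))"
      using that by (intro tendsto_intros LIMSEQ_inverse_real_of_nat) auto
    moreover have "flat 1 (real (Suc n) * y) = exp (- (inverse (real (Suc n)) / y))" for n
      using that by (simp add: flat_def divide_simps add_pos_nonneg)
    ultimately show ?thesis by simp
  qed
  have "(\<lambda>n. box_bump a b n x) \<longlonglongrightarrow> (\<Prod>i\<in>(Basis::'a set). 1 * 1)"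
    unfolding box_bump_def
    using True by (intro tendsto_prod tendsto_mult flat_lim) (auto simp: mem_box)
  then show ?thesis using True by simp
qed (simp add: box_bump_eq_0)

lemma test_function_box_bump:
  assumes "cbox a b \<subseteq> \<Omega>"
  shows "test_function \<Omega> (box_bump a b n)"
proof -
  have "{x. box_bump a b n x \<noteq> 0} \<subseteq> cbox a b"
    using box_bump_eq_0 box_subset_cbox by blast
  then have "closure {x. box_bump a b n x \<noteq> 0} \<subseteq> cbox a b"
    by (rule closure_minimal[OF _ closed_cbox])
  with assms show ?thesis
    unfolding test_function_def
    using bounded_subset[OF bounded_cbox, of _ a b]
    by (auto intro: Ck_box_bump simp: compact_eq_bounded_closed)
qed


section \<open>The fundamental lemma of the calculus of variations\<close>

lemma AE_lebesgue_on_open_iff: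
  fixes \<Omega> :: "'a::euclidean_space set"
  assumes "open \<Omega>"
  shows "(AE x in lebesgue_on \<Omega>. P x) \<longleftrightarrow> (AE x in lborel. x \<in> \<Omega> \<longrightarrow> P x)"
  using assms by (simp add: AE_restrict_space_iff AE_completion_iff borel_open)

text \<open>Restriction to \<open>\<Omega>\<close> is extension by zero, and completion does not
  change integrals of Borel functions. The transfer gives access to translation invariance and
  Fubini for \<open>lborel\<close>.\<close>

lemma integral_lebesgue_on_eq_lborel:
  fixes \<Omega> :: "'a::euclidean_space set" and f :: "'a \<Rightarrow> real"
  assumes "open \<Omega>" and "f \<in> borel_measurable (lebesgue_on \<Omega>)" and "g \<in> borel_measurable borel"
    and "AE x in lborel. g x = (if x \<in> \<Omega> then f x else 0)"
  shows "integral\<^sup>L (lebesgue_on \<Omega>) f = integral\<^sup>L lborel g"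
    and "integrable (lebesgue_on \<Omega>) f \<longleftrightarrow> integrable lborel g"
proof -
  have \<Omega>: "\<Omega> \<inter> space lebesgue \<in> sets lebesgue"
    using assms(1) by (simp add: borel_open)
  have m: "(\<lambda>x. indicator \<Omega> x *\<^sub>R f x) \<in> borel_measurable lebesgue"
    using assms(2) borel_measurable_restrict_space_iff[OF \<Omega>] by blast
  have g: "g \<in> borel_measurable lborel" "g \<in> borel_measurable lebesgue"
    using assms(3) by (auto intro: measurable_completion)
  have ae: "AE x in lebesgue. indicator \<Omega> x *\<^sub>R f x = g x"
    unfolding AE_completion_iff using assms(4) by eventually_elim auto
  have "integral\<^sup>L (lebesgue_on \<Omega>) f = integral\<^sup>L lebesgue g"
    unfolding integral_restrict_space[OF \<Omega>] using m g ae by (intro integral_cong_AE)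
  also have "\<dots> = integral\<^sup>L lborel g"
    using g by (intro integral_completion)
  finally show "integral\<^sup>L (lebesgue_on \<Omega>) f = integral\<^sup>L lborel g" .
  have "integrable (lebesgue_on \<Omega>) f \<longleftrightarrow> integrable lebesgue g"
    unfolding integrable_restrict_space[OF \<Omega>] using m g ae by (intro integrable_cong_AE)
  also have "\<dots> \<longleftrightarrow> integrable lborel g"
    using g by (intro integrable_completion)
  finally show "integrable (lebesgue_on \<Omega>) f \<longleftrightarrow> integrable lborel g" .
qed

text \<open>The extension by zero is measurable for the completion, hence equal almost everywhere to
  a Borel function. Integrability of \<open>g\<close> follows from |g| <= 1 + g^2, since
  \<open>\<Omega>\<close> has finite measure.\<close>

lemma L2_space_borel_representative:
  fixes \<Omega> :: "'a::euclidean_space set" and f :: "'a \<Rightarrow> real"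
  assumes "open \<Omega>" and "bounded \<Omega>" and "f \<in> L2_space \<Omega>"
  obtains g where "g \<in> borel_measurable borel"
    and "AE x in lborel. g x = (if x \<in> \<Omega> then f x else 0)"
    and "integrable lborel g" and "integrable lborel (\<lambda>x. (g x)\<^sup>2)"
proof -
  have f: "f \<in> borel_measurable (lebesgue_on \<Omega>)" "integrable (lebesgue_on \<Omega>) (\<lambda>x. (f x)\<^sup>2)"
    using assms(3) by (auto simp: L2_space_def)
  have "(\<lambda>x. if x \<in> \<Omega> then f x else 0) \<in> borel_measurable (completion lborel)"
    using f(1) assms(1) by (intro borel_measurable_if_I) (auto simp: borel_open)
  from completion_ex_borel_measurable_real[OF this]
  obtain g where g: "g \<in> borel_measurable lborel"
      "AE x in lborel. (if x \<in> \<Omega> then f x else 0) = g x"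
    by blast
  have gm[measurable]: "g \<in> borel_measurable borel" using g(1) by simp
  have ae: "AE x in lborel. g x = (if x \<in> \<Omega> then f x else 0)"
    using g(2) by eventually_elim auto
  have sq: "integrable lborel (\<lambda>x. (g x)\<^sup>2)"
    using f(2) ae
    by (subst integral_lebesgue_on_eq_lborel(2)[OF assms(1), of "\<lambda>x. (f x)\<^sup>2", symmetric])
      (use f(1) in auto)
  have "emeasure lborel \<Omega> < \<infinity>"
    by (rule emeasure_bounded_finite[OF assms(2)])
  then have "integrable lborel (indicator \<Omega> :: 'a \<Rightarrow> real)"
    using assms(1) by (intro integrable_real_indicator) (auto simp: borel_open)
  with sq have dom: "integrable lborel (\<lambda>x. indicator \<Omega> x + (g x)\<^sup>2)"
    by (rule Bochner_Integration.integrable_add[rotated])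
  have "integrable lborel g"
  proof (rule Bochner_Integration.integrable_bound[OF dom g(1)])
    show "AE x in lborel. norm (g x) \<le> norm (indicator \<Omega> x + (g x)\<^sup>2)"
      using ae
    proof eventually_elim
      case (elim x)
      have "\<bar>g x\<bar> \<le> 1 + (g x)\<^sup>2"
        using zero_le_power2[of "\<bar>g x\<bar> - 1"] zero_le_power2[of "g x"]
        by (simp add: power2_diff)
      then show ?case using elim by auto
    qed
  qed
  then show ?thesis using that gm ae sq by blast
qed

text \<open>Dynkin's argument: open boxes are stable under intersection and generate the Borel sets,
  and the sets on which \<open>f\<close> has integral 0 are closed under countable disjoint unions
  and, thanks to \<open>total\<close>, under complements. Thus \<open>f\<close> and 0 are densities
  of the same measure.\<close>

lemma AE_eq_0_if_integral_box_eq_0: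
  fixes f :: "'a::euclidean_space \<Rightarrow> real"
  assumes f: "integrable lborel f" and total: "integral\<^sup>L lborel f = 0"
    and box: "\<And>a b. (LINT x:box a b|lborel. f x) = 0"
  shows "AE x in lborel. f x = 0"
proof -
  have int: "set_integrable lborel A f" if "A \<in> sets borel" for A
    unfolding set_integrable_def using f that by (intro integrable_mult_indicator) auto
  have "(LINT x:A|lborel. f x) = 0" if "A \<in> sets borel" for A
  proof -
    have "Int_stable (range (\<lambda>(a, b). box a b :: 'a set))"
      by (auto simp: Int_stable_def box_Int_box)
    moreover have "range (\<lambda>(a, b). box a b :: 'a set) \<subseteq> Pow UNIV" by simp
    moreover have "A \<in> sigma_sets UNIV (range (\<lambda>(a, b). box a b :: 'a set))"
      using that by (simp add: borel_eq_box)
    ultimately show ?thesis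
    proof (induction rule: sigma_sets_induct_disjoint)
      case (basic A)
      then show ?case using box by auto
    next
      case empty
      then show ?case by (simp add: set_lebesgue_integral_def)
    next
      case (compl A)
      then have A: "A \<in> sets borel"
        by (simp add: borel_eq_box)
      then have "UNIV - A \<in> sets borel"
        by auto
      with A have "(LINT x:UNIV|lborel. f x) = (LINT x:A|lborel. f x) + (LINT x:(UNIV - A)|lborel. f x)"
        using set_integral_Un[of A "UNIV - A" lborel f] int by simp
      then show ?case
        using compl total set_integral_space[OF f] by simp
    next
      case (union A)
      then have A: "\<And>i. A i \<in> sets borel"
        by (auto simp: borel_eq_box image_subset_iff)
      have "(LINT x:(\<Union>i. A i)|lborel. f x) = (\<Sum>i. (LINT x:A i|lborel. f x))"
        using A union(1) by (intro lebesgue_integral_countable_add int) (auto simp: disjoint_family_on_def)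
      then show ?case using union by simp
    qed
  qed
  then show ?thesis
    using density_unique_real[OF f, of "\<lambda>_. 0"] by simp
qed

text \<open>Bumps converge boundedly to indicators of boxes, so \<open>q\<close> has integral 0 over
  every box whose closure lies in \<open>\<Omega>\<close>; countably many closed boxes then exhaust
  \<open>\<Omega>\<close>.\<close>

lemma fundamental_lemma_calculus_of_variations:
  fixes \<Omega> :: "'a::euclidean_space set"
  assumes "open \<Omega>" and "bounded \<Omega>" and "q \<in> L2_space \<Omega>"
    and zero: "\<And>\<psi>. test_function \<Omega> \<psi> \<Longrightarrow> (LINT x|lebesgue_on \<Omega>. q x * \<psi> x) = 0"
  shows "eq_ae \<Omega> q (\<lambda>_. 0)"
proof -
  obtain g where gm[measurable]: "g \<in> borel_measurable borel"
    and g: "AE x in lborel. g x = (if x \<in> \<Omega> then q x else 0)" "integrable lborel g"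
    by (rule L2_space_borel_representative[OF assms(1-3)])
  have q: "q \<in> borel_measurable (lebesgue_on \<Omega>)"
    using assms(3) by (simp add: L2_space_def)
  have bump: "(LINT x|lborel. g x * box_bump a b n x) = 0" if "cbox a b \<subseteq> \<Omega>" for a b n
  proof -
    have [measurable]: "box_bump a b n \<in> borel_measurable borel"
      using Ck_imp_continuous[OF Ck_box_bump] by (rule borel_measurable_continuous_onI)
    have "box_bump a b n \<in> borel_measurable (lebesgue_on \<Omega>)"
      by (intro measurable_restrict_space1 measurable_completion) simp
    with q have "(\<lambda>x. q x * box_bump a b n x) \<in> borel_measurable (lebesgue_on \<Omega>)"
      by (rule borel_measurable_times)
    moreover have "AE x in lborel. g x * box_bump a b n x = (if x \<in> \<Omega> then q x * box_bump a b n x else 0)"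
      using g(1) by eventually_elim auto
    ultimately have "(LINT x|lborel. g x * box_bump a b n x) = (LINT x|lebesgue_on \<Omega>. q x * box_bump a b n x)"
      by (intro integral_lebesgue_on_eq_lborel(1)[OF assms(1), symmetric]) simp_all
    then show ?thesis
      using zero[OF test_function_box_bump[OF that]] by simp
  qed
  have sub_box: "(LINT x|lborel. g x * indicator (box a b) x) = 0" if "cbox a b \<subseteq> \<Omega>" for a b
  proof -
    have "(\<lambda>n. LINT x|lborel. g x * box_bump a b n x)
        \<longlonglongrightarrow> (LINT x|lborel. g x * indicator (box a b) x)"
    proof (rule integral_dominated_convergence[where w="\<lambda>x. \<bar>g x\<bar>"])
      have "box_bump a b n \<in> borel_measurable borel" for n
        using Ck_imp_continuous[OF Ck_box_bump] by (rule borel_measurable_continuous_onI)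
      then show "(\<lambda>x. g x * box_bump a b n x) \<in> borel_measurable lborel" for n by simp
      show "AE x in lborel. norm (g x * box_bump a b n x) \<le> \<bar>g x\<bar>" for n
        by (simp add: abs_mult mult_left_le box_bump_bounds)
    qed (use g(2) in \<open>auto intro!: tendsto_mult box_bump_tendsto\<close>)
    then show ?thesis by (simp add: bump that LIMSEQ_const_iff)
  qed
  have on_cbox: "AE x in lborel. x \<in> cbox a b \<longrightarrow> g x = 0" if "cbox a b \<subseteq> \<Omega>" for a b
  proof -
    \<comment> \<open>Truncation to one box makes the vanishing hold on all boxes
      \<open>box c d\<close>, also those leaving \<open>\<Omega>\<close>: the intersection is a box
      whose closed version stays in \<open>cbox a b\<close>.\<close>
    have "AE x in lborel. g x * indicator (box a b) x = 0"
    proof (rule AE_eq_0_if_integral_box_eq_0)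
      show "integrable lborel (\<lambda>x. g x * indicator (box a b) x)"
        using g(2) by (intro integrable_real_mult_indicator) auto
      show "(LINT x|lborel. g x * indicator (box a b) x) = 0"
        using sub_box that .
      fix c d
      obtain l u where lu: "box a b \<inter> box c d = box l u" "cbox a b \<inter> cbox c d = cbox l u"
        using box_Int_box Int_interval by blast
      have "(LINT x:box c d|lborel. g x * indicator (box a b) x)
          = (LINT x|lborel. g x * indicator (box l u) x)"
        unfolding set_lebesgue_integral_def lu(1)[symmetric]
        by (intro Bochner_Integration.integral_cong) (auto simp: indicator_def)
      also have "\<dots> = 0"
        using lu(2) that by (intro sub_box) blast
      finally show "(LINT x:box c d|lborel. g x * indicator (box a b) x) = 0" .
    qed
    \<comment> \<open>The faces form a null set, so the result passes to the closed box, as the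
      covering by closed boxes requires.\<close>
    moreover have "AE x in lborel. x \<notin> cbox a b - box a b"
      using negligible_frontier_interval[of a b]
      by (intro AE_not_in) (simp add: negligible_iff_null_sets null_sets_completion_iff)
    ultimately show ?thesis
      by eventually_elim (auto simp: indicator_def)
  qed
  obtain \<D> where \<D>: "countable \<D>" "\<D> \<subseteq> Pow \<Omega>" "\<And>X. X \<in> \<D> \<Longrightarrow> \<exists>a b. X = cbox a b" "\<Union>\<D> = \<Omega>"
    using open_countable_Union_open_cbox[OF assms(1)] by blast
  have "AE x in lborel. \<forall>X\<in>\<D>. x \<in> X \<longrightarrow> g x = 0"
    using \<D>(1)
  proof (subst AE_ball_countable, safe)
    fix X assume "X \<in> \<D>"
    with \<D>(2,3) obtain a b where "X = cbox a b" "cbox a b \<subseteq> \<Omega>" by blast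
    then show "AE x in lborel. x \<in> X \<longrightarrow> g x = 0" using on_cbox by blast
  qed
  with g(1) have "AE x in lborel. x \<in> \<Omega> \<longrightarrow> q x = 0"
  proof eventually_elim
    case (elim x)
    with \<D>(4) have "x \<in> \<Omega> \<longrightarrow> g x = 0" by blast
    with elim show ?case by simp
  qed
  then show ?thesis
    by (simp add: eq_ae_def AE_lebesgue_on_open_iff[OF assms(1)])
qed


section \<open>A right inverse of the divergence\<close>

lemma lborel_translation:
  fixes f :: "'a::euclidean_space \<Rightarrow> real"
  assumes "f \<in> borel_measurable borel"
  shows "integral\<^sup>L lborel (\<lambda>x. f (x + c)) = integral\<^sup>L lborel f"
    and "integrable lborel (\<lambda>x. f (x + c)) \<longleftrightarrow> integrable lborel f"
proof -
  have "integral\<^sup>L lborel f = integral\<^sup>L (distr lborel borel ((+) c)) f"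
    by (simp add: lborel_distr_plus)
  also have "\<dots> = integral\<^sup>L lborel (\<lambda>x. f (x + c))"
    using assms by (subst integral_distr) (auto simp: add.commute)
  finally show "integral\<^sup>L lborel (\<lambda>x. f (x + c)) = integral\<^sup>L lborel f" by simp
  have "integrable lborel f \<longleftrightarrow> integrable (distr lborel borel ((+) c)) f"
    by (simp add: lborel_distr_plus)
  also have "\<dots> \<longleftrightarrow> integrable lborel (\<lambda>x. f (x + c))"
    using assms by (subst integrable_distr_eq) (auto simp: add.commute)
  finally show "integrable lborel (\<lambda>x. f (x + c)) \<longleftrightarrow> integrable lborel f" by simp
qed

text \<open>All slices in \<open>x\<close> have the same L1 norm up to the indicator, by translation
  invariance, and \<open>{a..b}\<close> has finite length.\<close>

lemma integrable_translates:
  fixes f :: "'a::euclidean_space \<Rightarrow> real" and a b :: real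
  assumes [measurable]: "f \<in> borel_measurable borel" and f: "integrable lborel f"
  shows "integrable (lborel \<Otimes>\<^sub>M lborel) (\<lambda>(s, x). indicator {a..b} s * f (x - s *\<^sub>R e))"
proof (rule lborel_pair.Fubini_integrable)
  show "(\<lambda>(s, x). indicator {a..b} s * f (x - s *\<^sub>R e)) \<in> borel_measurable (lborel \<Otimes>\<^sub>M lborel)"
    by measurable
  have abs: "(LINT x|lborel. \<bar>f (x - s *\<^sub>R e)\<bar>) = (LINT x|lborel. \<bar>f x\<bar>)" for s
    using lborel_translation(1)[of "\<lambda>x. \<bar>f x\<bar>" "- s *\<^sub>R e"] by simp
  show "integrable lborel (\<lambda>s. LINT x|lborel.
      norm (case (s, x) of (s, x) \<Rightarrow> indicator {a..b} s * f (x - s *\<^sub>R e)))"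
    by (simp add: abs_mult abs emeasure_lborel_Icc_eq)
  show "AE s in lborel. integrable lborel
      (\<lambda>x. case (s, x) of (s, x) \<Rightarrow> indicator {a..b} s * f (x - s *\<^sub>R e))"
    using lborel_translation(2)[of f "- s *\<^sub>R e" for s] f by simp
qed

text \<open>\<open>r \<mapsto> directional_primitive e R r\<close> is a right inverse of the derivative in direction \<open>e\<close>
  on functions supported in a set of diameter less than \<open>R\<close>.\<close>

definition directional_primitive ::
  "'a::euclidean_space \<Rightarrow> real \<Rightarrow> ('a \<Rightarrow> real) \<Rightarrow> 'a \<Rightarrow> real" where
  "directional_primitive e R r x = (LINT s|lborel. indicator {0..R} s * r (x - s *\<^sub>R e))"

lemma directional_primitive_measurable:
  assumes [measurable]: "r \<in> borel_measurable borel"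
  shows "directional_primitive e R r \<in> borel_measurable borel"
proof -
  have "(\<lambda>x. LINT s|lborel. indicator {0..R} s * r (x - s *\<^sub>R e)) \<in> borel_measurable lborel"
    by measurable
  then show ?thesis unfolding directional_primitive_def by simp
qed

text \<open>Pointwise, the square of the primitive is at most \<open>R\<close> times the integral of
  the squared translates, which Fubini shows to be integrable in \<open>x\<close>.\<close>

lemma directional_primitive_square_integrable:
  fixes r :: "'a::euclidean_space \<Rightarrow> real"
  assumes [measurable]: "r \<in> borel_measurable borel"
    and r: "integrable lborel r" and r2: "integrable lborel (\<lambda>x. (r x)\<^sup>2)" and "0 < R"
  shows "integrable lborel (\<lambda>x. (directional_primitive e R r x)\<^sup>2)"
proof -
  let ?I = "indicator {0..R} :: real \<Rightarrow> real"
  have int2: "integrable (lborel \<Otimes>\<^sub>M lborel) (\<lambda>(s, x). ?I s * (r (x - s *\<^sub>R e))\<^sup>2)"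
    using integrable_translates[OF _ r2] by simp
  have int: "integrable (lborel \<Otimes>\<^sub>M lborel) (\<lambda>(s, x). ?I s * r (x - s *\<^sub>R e))"
    by (rule integrable_translates[OF assms(1) r])
  define W where "W x = (LINT s|lborel. ?I s * (r (x - s *\<^sub>R e))\<^sup>2)" for x
  have "integrable lborel (\<lambda>x. R * W x)"
    unfolding W_def using lborel_pair.integrable_snd[OF int2]
    by (intro integrable_mult_right) simp
  moreover have "(\<lambda>x. (directional_primitive e R r x)\<^sup>2) \<in> borel_measurable lborel"
    using directional_primitive_measurable[of r e R] by simp
  moreover have "AE x in lborel. norm ((directional_primitive e R r x)\<^sup>2) \<le> norm (R * W x)"
    using lborel_pair.AE_integrable_snd[OF int] lborel_pair.AE_integrable_snd[OF int2]
  proof eventually_elim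
    case (elim x)
    let ?V = "directional_primitive e R r x"
    have I: "integrable lborel ?I" "integral\<^sup>L lborel ?I = R"
      using \<open>0 < R\<close> by simp_all
    \<comment> \<open>Cauchy-Schwarz on \<open>{0..R}\<close>: the variance of the translates is nonnegative.\<close>
    have "0 \<le> (LINT s|lborel. ?I s * (r (x - s *\<^sub>R e) - ?V / R)\<^sup>2)"
      by (intro integral_nonneg_AE) simp
    also have "(\<lambda>s. ?I s * (r (x - s *\<^sub>R e) - ?V / R)\<^sup>2) =
        (\<lambda>s. ?I s * (r (x - s *\<^sub>R e))\<^sup>2 - 2 * (?V / R) * (?I s * r (x - s *\<^sub>R e)) + (?V / R)\<^sup>2 * ?I s)"
      by (auto simp: power2_eq_square algebra_simps)
    also have "integral\<^sup>L lborel \<dots> = W x - 2 * (?V / R) * ?V + (?V / R)\<^sup>2 * R"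
      using elim I by (simp add: W_def directional_primitive_def)
    finally have "?V\<^sup>2 / R \<le> W x"
      using \<open>0 < R\<close> by (simp add: power2_eq_square)
    then show ?case
      using \<open>0 < R\<close> by (simp add: field_simps)
  qed
  ultimately show ?thesis
    by (rule Bochner_Integration.integrable_bound)
qed

text \<open>The adjoint of integration along -e is integration along e: Fubini, the substitution of
  x + s e for x, and Fubini again. Boundedness of \<open>D\<close> provides the integrability on the
  product space.\<close>

lemma integral_directional_primitive:
  fixes r D :: "'a::euclidean_space \<Rightarrow> real"
  assumes [measurable]: "r \<in> borel_measurable borel" "D \<in> borel_measurable borel"
    and r: "integrable lborel r" and D: "\<And>x. \<bar>D x\<bar> \<le> B"
  shows "(LINT x|lborel. directional_primitive e R r x * D x) =
    (LINT x|lborel. r x * (LINT s|lborel. indicator {0..R} s * D (x + s *\<^sub>R e)))"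
proof -
  let ?I = "indicator {0..R} :: real \<Rightarrow> real"
  have int: "integrable (lborel \<Otimes>\<^sub>M lborel) (\<lambda>(s, x). ?I s * r (x - s *\<^sub>R e))"
    by (rule integrable_translates[OF assms(1) r])
  have bound: "\<bar>D x * y\<bar> \<le> \<bar>B * y\<bar>" for x y
    using order_trans[OF D abs_ge_self] by (simp add: abs_mult mult_right_mono)
  have int1: "integrable (lborel \<Otimes>\<^sub>M lborel) (\<lambda>(s, x). D x * (?I s * r (x - s *\<^sub>R e)))"
    by (rule Bochner_Integration.integrable_bound[OF integrable_mult_right[OF int, of B]])
      (auto intro!: AE_I2 bound)
  \<comment> \<open>The zero translation direction gives the untranslated product.\<close>
  have "integrable (lborel \<Otimes>\<^sub>M lborel) (\<lambda>(s, x). ?I s * r x)"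
    using integrable_translates[OF assms(1) r, of 0 R 0] by simp
  from integrable_mult_right[OF this, of B]
  have int2: "integrable (lborel \<Otimes>\<^sub>M lborel) (\<lambda>(s, x). D (x + s *\<^sub>R e) * (?I s * r x))"
    by (rule Bochner_Integration.integrable_bound) (auto intro!: AE_I2 bound)
  have "(LINT x|lborel. directional_primitive e R r x * D x) =
      (LINT x|lborel. LINT s|lborel. D x * (?I s * r (x - s *\<^sub>R e)))"
    unfolding directional_primitive_def by (simp add: mult.commute)
  also have "\<dots> = (LINT s|lborel. LINT x|lborel. D x * (?I s * r (x - s *\<^sub>R e)))"
    by (rule lborel_pair.Fubini_integral[OF int1])
  also have "\<dots> = (LINT s|lborel. LINT x|lborel. D (x + s *\<^sub>R e) * (?I s * r x))"
  proof (rule arg_cong[where f="integral\<^sup>L lborel"], rule ext)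
    fix s
    show "(LINT x|lborel. D x * (?I s * r (x - s *\<^sub>R e))) = (LINT x|lborel. D (x + s *\<^sub>R e) * (?I s * r x))"
      using lborel_translation(1)[of "\<lambda>x. D x * (?I s * r (x - s *\<^sub>R e))" "s *\<^sub>R e"] by simp
  qed
  also have "\<dots> = (LINT x|lborel. LINT s|lborel. D (x + s *\<^sub>R e) * (?I s * r x))"
    by (rule lborel_pair.Fubini_integral[OF int2, symmetric])
  also have "\<dots> = (LINT x|lborel. r x * (LINT s|lborel. ?I s * D (x + s *\<^sub>R e)))"
    by (simp add: mult_ac)
  finally show ?thesis .
qed

section \<open>Test functions and their directional derivatives\<close>

lemma inner_grad: "e \<in> Basis \<Longrightarrow> grad f x \<bullet> e = frechet_derivative f (at x) e"
  by (simp add: grad_def inner_sum_left inner_Basis if_distrib sum.delta cong: if_cong)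

lemma test_function_eq_0: "test_function \<Omega> \<psi> \<Longrightarrow> x \<notin> \<Omega> \<Longrightarrow> \<psi> x = 0"
  using closure_subset[of "{x. \<psi> x \<noteq> 0}"] by (auto simp: test_function_def)

lemma test_function_continuous: "test_function \<Omega> \<psi> \<Longrightarrow> continuous_on UNIV \<psi>"
  unfolding test_function_def by (blast intro: Ck_imp_continuous)

lemma test_function_has_derivative:
  "test_function \<Omega> \<psi> \<Longrightarrow> (\<psi> has_derivative frechet_derivative \<psi> (at x)) (at x)"
  by (rule Ck_Suc_has_derivative[of 0]) (metis test_function_def)

lemma test_function_continuous_derivative:
  "test_function \<Omega> \<psi> \<Longrightarrow> e \<in> Basis \<Longrightarrow> continuous_on UNIV (\<lambda>x. frechet_derivative \<psi> (at x) e)"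
  unfolding test_function_def by (metis Ck.simps)

text \<open>Off the closed support the function is 0 in a whole neighbourhood.\<close>

lemma test_function_derivative_eq_0:
  assumes "x \<notin> closure {x. \<psi> x \<noteq> 0}"
  shows "frechet_derivative \<psi> (at x) e = 0"
proof -
  have "((\<lambda>_. 0) has_derivative (\<lambda>_. 0)) (at x)" by simp
  then have "(\<psi> has_derivative (\<lambda>_. 0)) (at x)"
    by (rule has_derivative_transform_within_open[where s="- closure {x. \<psi> x \<noteq> 0}"])
      (use assms closure_subset[of "{x. \<psi> x \<noteq> 0}"] in auto)
  then show ?thesis
    using frechet_derivative_at by metis
qed

lemma continuous_compact_support_bounded:
  fixes f :: "'a::euclidean_space \<Rightarrow> real"
  assumes "continuous_on UNIV f" and "compact K" and "\<And>x. x \<notin> K \<Longrightarrow> f x = 0"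
  obtains B where "\<And>x. \<bar>f x\<bar> \<le> B"
proof -
  have "compact (f ` K)"
    using assms(1,2) by (blast intro: compact_continuous_image continuous_on_subset)
  then obtain B where B: "\<And>x. x \<in> K \<Longrightarrow> \<bar>f x\<bar> \<le> B"
    using compact_imp_bounded by (fastforce simp: bounded_iff)
  \<comment> \<open>The maximum with 0 covers the points off \<open>K\<close>, also when
    \<open>K\<close> is empty and \<open>B\<close> is arbitrary.\<close>
  have "\<bar>f x\<bar> \<le> max B 0" for x
    using B[of x] assms(3)[of x] by (cases "x \<in> K") (simp_all add: le_max_iff_disj)
  then show ?thesis by (rule that)
qed

lemma test_function_integral_derivative:
  assumes "test_function \<Omega> \<psi>" and "e \<in> Basis" and "0 \<le> R"
  shows "(LINT s|lborel. indicator {0..R} s * frechet_derivative \<psi> (at (x + s *\<^sub>R e)) e) =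
    \<psi> (x + R *\<^sub>R e) - \<psi> x"
proof -
  let ?D = "\<lambda>x. frechet_derivative \<psi> (at x) e"
  have "((\<lambda>s. \<psi> (x + s *\<^sub>R e)) has_real_derivative ?D (x + s *\<^sub>R e)) (at s)" for s
  proof -
    let ?F = "frechet_derivative \<psi> (at (x + s *\<^sub>R e))"
    have \<psi>: "(\<psi> has_derivative ?F) (at (x + s *\<^sub>R e))"
      by (rule test_function_has_derivative[OF assms(1)])
    have "((\<lambda>s. \<psi> (x + s *\<^sub>R e)) has_derivative (\<lambda>h. ?F (h *\<^sub>R e))) (at s)"
      by (rule has_derivative_compose[where f="\<lambda>s. x + s *\<^sub>R e" and g=\<psi>, OF _ \<psi>])
        (auto intro!: derivative_eq_intros)
    moreover have "?F (h *\<^sub>R e) = ?D (x + s *\<^sub>R e) * h" for h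
      using linear_scale[OF has_derivative_linear[OF \<psi>]] by (simp add: mult.commute)
    ultimately show ?thesis by (simp add: has_field_derivative_def)
  qed
  moreover have "isCont (\<lambda>s. ?D (x + s *\<^sub>R e)) s" for s
  proof -
    have "continuous_on UNIV (\<lambda>s. ?D (x + s *\<^sub>R e))"
      by (rule continuous_on_compose2[OF test_function_continuous_derivative[OF assms(1,2)]])
        (auto intro!: continuous_intros)
    then show ?thesis by (simp add: continuous_on_eq_continuous_at)
  qed
  ultimately show ?thesis
    using integral_FTC_Icc_real[OF assms(3), of "\<lambda>s. \<psi> (x + s *\<^sub>R e)" "\<lambda>s. ?D (x + s *\<^sub>R e)"]
    by (simp add: mult.commute)
qed

section \<open>Fields with prescribed weak divergence\<close>

lemma ex_directional_weak_divergence: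
  fixes \<Omega> :: "'a::euclidean_space set"
  assumes "open \<Omega>" and "bounded \<Omega>" and "q \<in> L2_space \<Omega>" and e: "e \<in> Basis"
  obtains V where "V \<in> borel_measurable borel" and "integrable lborel (\<lambda>x. (V x)\<^sup>2)"
    and "has_weak_divergence \<Omega> (\<lambda>x. V x *\<^sub>R e) q"
proof -
  obtain g where gm[measurable]: "g \<in> borel_measurable borel"
    and g: "AE x in lborel. g x = (if x \<in> \<Omega> then q x else 0)" "integrable lborel g"
      "integrable lborel (\<lambda>x. (g x)\<^sup>2)"
    by (rule L2_space_borel_representative[OF assms(1-3)])
  obtain B where B: "0 < B" "\<And>x. x \<in> \<Omega> \<Longrightarrow> norm x \<le> B"
    using assms(2) by (auto simp: bounded_pos)
  \<comment> \<open>This exceeds the diameter of \<open>\<Omega>\<close>, so a shift by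
    \<open>R\<close> along \<open>e\<close> moves every point of \<open>\<Omega>\<close> out of
    it.\<close>
  define R where "R = 2 * B + 1"
  have out: "x + R *\<^sub>R e \<notin> \<Omega>" if "x \<in> \<Omega>" for x
  proof
    assume "x + R *\<^sub>R e \<in> \<Omega>"
    moreover have "norm (R *\<^sub>R e) \<le> norm (x + R *\<^sub>R e) + norm x"
      using norm_triangle_ineq4[of "x + R *\<^sub>R e" x] by simp
    ultimately show False
      using B(1) B(2)[of "x + R *\<^sub>R e"] B(2)[OF that] e by (simp add: R_def)
  qed
  define V where "V = directional_primitive e R g"
  have Vm[measurable]: "V \<in> borel_measurable borel"
    unfolding V_def using directional_primitive_measurable[OF gm, of e R] by simp
  moreover have "integrable lborel (\<lambda>x. (V x)\<^sup>2)"
    unfolding V_def using directional_primitive_square_integrable[OF gm g(2,3), where e=e and R=R] B(1)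
    by (simp add: R_def)
  moreover have "has_weak_divergence \<Omega> (\<lambda>x. V x *\<^sub>R e) q"
    unfolding has_weak_divergence_def
  proof (intro allI impI)
    fix \<psi> assume \<psi>: "test_function \<Omega> \<psi>"
    define D where "D x = frechet_derivative \<psi> (at x) e" for x
    have [measurable]: "D \<in> borel_measurable borel" "\<psi> \<in> borel_measurable borel"
      unfolding D_def using test_function_continuous_derivative[OF \<psi> e] test_function_continuous[OF \<psi>]
      by (auto intro!: borel_measurable_continuous_onI)
    have meas: "f \<in> borel_measurable (lebesgue_on \<Omega>)" if "f \<in> borel_measurable borel" for f :: "'a \<Rightarrow> real"
      using that by (intro measurable_restrict_space1 measurable_completion) simp
    have qm: "q \<in> borel_measurable (lebesgue_on \<Omega>)"
      using assms(3) by (simp add: L2_space_def)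
    have D0: "D x = 0" if "x \<notin> \<Omega>" for x
      unfolding D_def using \<psi> that
      by (intro test_function_derivative_eq_0) (auto simp: test_function_def)
    obtain C where C: "\<And>x. \<bar>D x\<bar> \<le> C"
      unfolding D_def by (rule continuous_compact_support_bounded[OF test_function_continuous_derivative[OF \<psi> e],
            of "closure {x. \<psi> x \<noteq> 0}"])
        (use \<psi> in \<open>auto simp: test_function_def test_function_derivative_eq_0\<close>)
    have "(LINT x|lebesgue_on \<Omega>. (V x *\<^sub>R e) \<bullet> grad \<psi> x) =
        (LINT x|lebesgue_on \<Omega>. directional_primitive e R g x * D x)"
      by (simp add: V_def D_def inner_grad[OF e] inner_commute[of e])
    \<comment> \<open>The primitive may be nonzero outside \<open>\<Omega>\<close>, but
      \<open>D\<close> vanishes there, so the integral extends to the whole space.\<close>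
    also have "\<dots> = (LINT x|lborel. directional_primitive e R g x * D x)"
      using directional_primitive_measurable[OF gm, of e R]
      by (intro integral_lebesgue_on_eq_lborel(1)[OF assms(1)] meas AE_I2) (auto simp: D0)
    also have "\<dots> = (LINT x|lborel. g x * (\<psi> (x + R *\<^sub>R e) - \<psi> x))"
      using integral_directional_primitive[OF gm _ g(2) C, where e=e and R=R] B(1)
        test_function_integral_derivative[OF \<psi> e, of R]
      by (simp add: D_def[symmetric] R_def)
    also have "\<dots> = (LINT x|lborel. - (g x * \<psi> x))"
    proof (rule integral_cong_AE)
      \<comment> \<open>Almost everywhere off \<open>\<Omega>\<close> the factor \<open>g\<close> is
        0; on \<open>\<Omega>\<close> the shifted argument has left the support of
        \<open>\<psi>\<close>.\<close>
      show "AE x in lborel. g x * (\<psi> (x + R *\<^sub>R e) - \<psi> x) = - (g x * \<psi> x)"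
        using g(1) by eventually_elim (auto simp: test_function_eq_0[OF \<psi> out])
    qed simp_all
    also have "\<dots> = - (LINT x|lborel. g x * \<psi> x)"
      by simp
    also have "(LINT x|lborel. g x * \<psi> x) = (LINT x|lebesgue_on \<Omega>. q x * \<psi> x)"
    proof (rule integral_lebesgue_on_eq_lborel(1)[OF assms(1), symmetric])
      show "AE x in lborel. g x * \<psi> x = (if x \<in> \<Omega> then q x * \<psi> x else 0)"
        using g(1) by eventually_elim auto
      show "(\<lambda>x. q x * \<psi> x) \<in> borel_measurable (lebesgue_on \<Omega>)"
        using qm meas[of \<psi>] by (intro borel_measurable_times) simp_all
    qed simp
    finally show "(LINT x|lebesgue_on \<Omega>. q x * \<psi> x) = - (LINT x|lebesgue_on \<Omega>. (V x *\<^sub>R e) \<bullet> grad \<psi> x)"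
      by simp
  qed
  ultimately show ?thesis
    by (rule that)
qed

text \<open>Take w = (V / \<rho>) e. Then \<open>\<rho>\<close> w = V e on \<open>\<Omega>\<close>,
  and the lower bound \<open>m\<close> gives |w|^2 <= V^2 / m^2.\<close>

lemma ex_weighted_weak_divergence:
  fixes \<Omega> :: "'a::euclidean_space set" and \<rho> :: "'a \<Rightarrow> real"
  assumes "open \<Omega>" and "bounded \<Omega>" and q: "q \<in> L2_space \<Omega>"
    and \<rho>m: "\<rho> \<in> borel_measurable (lebesgue_on \<Omega>)"
    and \<rho>: "0 < m" "\<And>x. x \<in> \<Omega> \<Longrightarrow> m \<le> \<rho> x"
  shows "\<exists>w\<in>L2_space \<Omega>. has_weak_divergence \<Omega> (\<lambda>x. \<rho> x *\<^sub>R w x) q"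
proof -
  obtain e :: 'a where e: "e \<in> Basis" using nonempty_Basis by blast
  obtain V where V: "V \<in> borel_measurable borel" "integrable lborel (\<lambda>x. (V x)\<^sup>2)"
    "has_weak_divergence \<Omega> (\<lambda>x. V x *\<^sub>R e) q"
    by (rule ex_directional_weak_divergence[OF assms(1,2) q e])
  define w where "w x = (V x / \<rho> x) *\<^sub>R e" for x
  have Vm: "V \<in> borel_measurable (lebesgue_on \<Omega>)"
    using V(1) by (intro measurable_restrict_space1 measurable_completion) simp
  have wm: "w \<in> borel_measurable (lebesgue_on \<Omega>)"
    unfolding w_def using Vm \<rho>m by (intro borel_measurable_scaleR borel_measurable_divide) auto
  have "integrable lebesgue (\<lambda>x. (V x)\<^sup>2)"
    using V(1,2) by (subst integrable_completion) auto
  then have "integrable (lebesgue_on \<Omega>) (\<lambda>x. (V x)\<^sup>2)"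
    using assms(1)
    by (subst integrable_restrict_space) (auto intro!: integrable_mult_indicator simp: borel_open simp del: real_scaleR_def)
  then have "integrable (lebesgue_on \<Omega>) (\<lambda>x. (V x)\<^sup>2 / m\<^sup>2)"
    by simp
  then have "integrable (lebesgue_on \<Omega>) (\<lambda>x. (norm (w x))\<^sup>2)"
  proof (rule Bochner_Integration.integrable_bound)
    show "AE x in lebesgue_on \<Omega>. norm ((norm (w x))\<^sup>2) \<le> norm ((V x)\<^sup>2 / m\<^sup>2)"
    proof (rule AE_I2)
      fix x assume "x \<in> space (lebesgue_on \<Omega>)"
      then have "m \<le> \<rho> x" using \<rho>(2) by simp
      then have "(V x)\<^sup>2 / (\<rho> x)\<^sup>2 \<le> (V x)\<^sup>2 / m\<^sup>2"
        using \<rho>(1) by (intro divide_left_mono power_mono) auto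
      then show "norm ((norm (w x))\<^sup>2) \<le> norm ((V x)\<^sup>2 / m\<^sup>2)"
        using e by (simp add: w_def power_divide)
    qed
  qed (use wm in measurable)
  then have "w \<in> L2_space \<Omega>" using wm by (simp add: L2_space_def)
  moreover have "(LINT x|lebesgue_on \<Omega>. (\<rho> x *\<^sub>R w x) \<bullet> grad \<psi> x) =
      (LINT x|lebesgue_on \<Omega>. (V x *\<^sub>R e) \<bullet> grad \<psi> x)" for \<psi>
  proof (rule Bochner_Integration.integral_cong)
    fix x assume "x \<in> space (lebesgue_on \<Omega>)"
    then have "0 < \<rho> x" using \<rho>(1) \<rho>(2)[of x] by simp
    then show "(\<rho> x *\<^sub>R w x) \<bullet> grad \<psi> x = (V x *\<^sub>R e) \<bullet> grad \<psi> x"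
      by (simp add: w_def)
  qed simp
  with V(3) have "has_weak_divergence \<Omega> (\<lambda>x. \<rho> x *\<^sub>R w x) q"
    by (simp add: has_weak_divergence_def)
  ultimately show ?thesis by blast
qed


section \<open>Semigroups and mild solutions\<close>

lemma L2_space_linear_combination:
  fixes f g :: "'a::euclidean_space \<Rightarrow> real"
  assumes "f \<in> L2_space \<Omega>" and "g \<in> L2_space \<Omega>"
  shows "(\<lambda>x. a * f x + b * g x) \<in> L2_space \<Omega>"
proof -
  have [measurable]: "f \<in> borel_measurable (lebesgue_on \<Omega>)" "g \<in> borel_measurable (lebesgue_on \<Omega>)"
    using assms by (auto simp: L2_space_def)
  have "integrable (lebesgue_on \<Omega>) (\<lambda>x. 2 * (a\<^sup>2 * (f x)\<^sup>2) + 2 * (b\<^sup>2 * (g x)\<^sup>2))"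
    using assms by (simp add: L2_space_def)
  then have "integrable (lebesgue_on \<Omega>) (\<lambda>x. (a * f x + b * g x)\<^sup>2)"
  proof (rule Bochner_Integration.integrable_bound)
    have "(a * f x + b * g x)\<^sup>2 \<le> 2 * (a\<^sup>2 * (f x)\<^sup>2) + 2 * (b\<^sup>2 * (g x)\<^sup>2)" for x
      using zero_le_power2[of "a * f x - b * g x"]
      by (simp add: power2_sum power2_diff power_mult_distrib)
    then show "AE x in lebesgue_on \<Omega>. norm ((a * f x + b * g x)\<^sup>2) \<le>
        norm (2 * (a\<^sup>2 * (f x)\<^sup>2) + 2 * (b\<^sup>2 * (g x)\<^sup>2))"
      by simp
  qed measurable
  then show ?thesis by (simp add: L2_space_def)
qed

text \<open>Needed because the semigroup laws hold only up to null sets while the norm is applied to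
  functions.\<close>

lemma L2_norm_cong_AE:
  assumes "eq_ae \<Omega> f g" and "f \<in> L2_space \<Omega>" and "g \<in> L2_space \<Omega>"
    and [measurable]: "\<rho> \<in> borel_measurable (lebesgue_on \<Omega>)"
  shows "L2_norm \<Omega> \<rho> f = L2_norm \<Omega> \<rho> g"
proof -
  have [measurable]: "f \<in> borel_measurable (lebesgue_on \<Omega>)" "g \<in> borel_measurable (lebesgue_on \<Omega>)"
    using assms(2,3) by (auto simp: L2_space_def)
  have "(LINT x|lebesgue_on \<Omega>. \<rho> x * (f x)\<^sup>2) = (LINT x|lebesgue_on \<Omega>. \<rho> x * (g x)\<^sup>2)"
  proof (rule integral_cong_AE)
    show "AE x in lebesgue_on \<Omega>. \<rho> x * (f x)\<^sup>2 = \<rho> x * (g x)\<^sup>2"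
      using assms(1) unfolding eq_ae_def by eventually_elim simp
  qed measurable
  then show ?thesis by (simp add: L2_norm_def)
qed

text \<open>Links the weighted norm, in which the semigroup contracts, to the unweighted norm of
  \<open>continuous_L2\<close>. The upper bound \<open>M\<close> ensures that the weighted integrand
  is integrable, as monotonicity of the integral requires.\<close>

lemma L2_norm_le_weighted_L2_norm:
  assumes "f \<in> L2_space \<Omega>" and [measurable]: "\<rho> \<in> borel_measurable (lebesgue_on \<Omega>)"
    and "0 < m" and \<rho>: "\<And>x. x \<in> \<Omega> \<Longrightarrow> m \<le> \<rho> x \<and> \<rho> x \<le> M"
  shows "L2_norm \<Omega> (\<lambda>_. 1) f \<le> L2_norm \<Omega> \<rho> f / sqrt m"
proof -
  have [measurable]: "f \<in> borel_measurable (lebesgue_on \<Omega>)"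
    and f: "integrable (lebesgue_on \<Omega>) (\<lambda>x. (f x)\<^sup>2)"
    using assms(1) by (auto simp: L2_space_def)
  have weighted: "integrable (lebesgue_on \<Omega>) (\<lambda>x. \<rho> x * (f x)\<^sup>2)"
  proof (rule Bochner_Integration.integrable_bound[OF integrable_mult_right[OF f, of M]])
    show "AE x in lebesgue_on \<Omega>. norm (\<rho> x * (f x)\<^sup>2) \<le> norm (M * (f x)\<^sup>2)"
      using \<rho> \<open>0 < m\<close> by (intro AE_I2) (fastforce simp: abs_mult intro!: mult_right_mono)
  qed measurable
  have "m * (LINT x|lebesgue_on \<Omega>. (f x)\<^sup>2) = (LINT x|lebesgue_on \<Omega>. m * (f x)\<^sup>2)"
    by simp
  also have "\<dots> \<le> (LINT x|lebesgue_on \<Omega>. \<rho> x * (f x)\<^sup>2)"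
    by (intro integral_mono integrable_mult_right f weighted mult_right_mono) (use \<rho> in auto)
  finally have "sqrt (m * (LINT x|lebesgue_on \<Omega>. (f x)\<^sup>2)) \<le> L2_norm \<Omega> \<rho> f"
    by (simp add: L2_norm_def)
  then show ?thesis
    using \<open>0 < m\<close> by (simp add: L2_norm_def real_sqrt_mult field_simps)
qed

text \<open>The increment is S(s) applied to S(d) f - f, and S(s) is a contraction.\<close>

lemma semigroup_increment_le:
  fixes f :: "'a::euclidean_space \<Rightarrow> real"
  assumes S: "contraction_C0_semigroup \<Omega> \<rho> S" and f: "f \<in> L2_space \<Omega>"
    and \<rho>: "\<rho> \<in> borel_measurable (lebesgue_on \<Omega>)" and "0 \<le> s" "0 \<le> d"
  shows "L2_norm \<Omega> \<rho> (\<lambda>x. S (s + d) f x - S s f x) \<le> L2_norm \<Omega> \<rho> (\<lambda>x. S d f x - f x)"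
proof -
  have L2: "\<And>t g. 0 \<le> t \<Longrightarrow> g \<in> L2_space \<Omega> \<Longrightarrow> S t g \<in> L2_space \<Omega>"
    and contr: "\<And>t g. 0 \<le> t \<Longrightarrow> g \<in> L2_space \<Omega> \<Longrightarrow> L2_norm \<Omega> \<rho> (S t g) \<le> L2_norm \<Omega> \<rho> g"
    and lin: "\<And>t g k a b. 0 \<le> t \<Longrightarrow> g \<in> L2_space \<Omega> \<Longrightarrow> k \<in> L2_space \<Omega> \<Longrightarrow>
        eq_ae \<Omega> (S t (\<lambda>x. a * g x + b * k x)) (\<lambda>x. a * S t g x + b * S t k x)"
    and add: "eq_ae \<Omega> (S (s + d) f) (S s (S d f))"
    using S f assms(4,5) by (auto simp: contraction_C0_semigroup_def)
  have diff: "(\<lambda>x. g x - k x) \<in> L2_space \<Omega>" if "g \<in> L2_space \<Omega>" "k \<in> L2_space \<Omega>" for g k :: "'a \<Rightarrow> real"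
    using L2_space_linear_combination[OF that, of 1 "-1"] by simp
  let ?g = "\<lambda>x. S d f x - f x"
  have g: "?g \<in> L2_space \<Omega>" using diff L2 f assms(5) by simp
  have "eq_ae \<Omega> (S s ?g) (\<lambda>x. S s (S d f) x - S s f x)"
    using lin[OF assms(4) L2[OF assms(5) f] f, of 1 "-1"] by simp
  with add have "eq_ae \<Omega> (\<lambda>x. S (s + d) f x - S s f x) (S s ?g)"
    unfolding eq_ae_def by eventually_elim simp
  then have "L2_norm \<Omega> \<rho> (\<lambda>x. S (s + d) f x - S s f x) = L2_norm \<Omega> \<rho> (S s ?g)"
    using L2 diff f g assms(4,5) by (intro L2_norm_cong_AE \<rho>) simp_all
  with contr[OF assms(4) g] show ?thesis by simp
qed

text \<open>Increments are controlled by the increment at time 0 over the span |s - t|, with the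
  earlier time as base point. Strong continuity at 0 from the right thus yields two-sided
  continuity.\<close>

lemma mild_solution_continuous_L2:
  fixes h\<^sub>I :: "'a::euclidean_space \<Rightarrow> real"
  assumes S: "contraction_C0_semigroup \<Omega> \<rho> S" and hI: "h\<^sub>I \<in> L2_space \<Omega>"
    and \<rho>m: "\<rho> \<in> borel_measurable (lebesgue_on \<Omega>)"
    and \<rho>: "0 < m" "\<And>x. x \<in> \<Omega> \<Longrightarrow> m \<le> \<rho> x \<and> \<rho> x \<le> M"
    and h: "mild_solution \<Omega> S \<tau> h\<^sub>I h"
  shows "continuous_L2 \<Omega> \<tau> h"
  unfolding continuous_L2_def
proof (intro ballI conjI)
  fix t assume t: "t \<in> {0..\<tau>}"
  show "h t \<in> L2_space \<Omega>" using h t by (simp add: mild_solution_def)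
  define \<phi> where "\<phi> d = L2_norm \<Omega> \<rho> (\<lambda>x. S d h\<^sub>I x - h\<^sub>I x)" for d
  have diff: "(\<lambda>x. g x - k x) \<in> L2_space \<Omega>" if "g \<in> L2_space \<Omega>" "k \<in> L2_space \<Omega>" for g k :: "'a \<Rightarrow> real"
    using L2_space_linear_combination[OF that, of 1 "-1"] by simp
  have SL2: "S s h\<^sub>I \<in> L2_space \<Omega>" if "0 \<le> s" for s
    using S hI that by (simp add: contraction_C0_semigroup_def)
  have bound: "norm (L2_norm \<Omega> (\<lambda>_. 1) (\<lambda>x. h s x - h t x)) \<le> \<phi> \<bar>s - t\<bar> / sqrt m"
    if s: "s \<in> {0..\<tau>}" for s
  proof -
    have L2: "h s \<in> L2_space \<Omega>" "h t \<in> L2_space \<Omega>"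
      and eq: "eq_ae \<Omega> (h s) (S s h\<^sub>I)" "eq_ae \<Omega> (h t) (S t h\<^sub>I)"
      using h s t by (auto simp: mild_solution_def)
    have "L2_norm \<Omega> (\<lambda>_. 1) (\<lambda>x. h s x - h t x) \<le> L2_norm \<Omega> \<rho> (\<lambda>x. h s x - h t x) / sqrt m"
      by (rule L2_norm_le_weighted_L2_norm[OF diff[OF L2] \<rho>m \<rho>])
    also have "L2_norm \<Omega> \<rho> (\<lambda>x. h s x - h t x) = L2_norm \<Omega> \<rho> (\<lambda>x. S s h\<^sub>I x - S t h\<^sub>I x)"
    proof (rule L2_norm_cong_AE)
      show "eq_ae \<Omega> (\<lambda>x. h s x - h t x) (\<lambda>x. S s h\<^sub>I x - S t h\<^sub>I x)"
        using eq unfolding eq_ae_def by eventually_elim simp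
    qed (use diff L2 SL2 s t \<rho>m in auto)
    also have "\<dots> \<le> \<phi> \<bar>s - t\<bar>"
    proof (cases "t \<le> s")
      case True
      then show ?thesis
        using semigroup_increment_le[OF S hI \<rho>m, of t "s - t"] t by (simp add: \<phi>_def)
    next
      case False
      then show ?thesis
        using semigroup_increment_le[OF S hI \<rho>m, of s "t - s"] s
        by (simp add: \<phi>_def L2_norm_def power2_commute[of "S s h\<^sub>I _"])
    qed
    finally show ?thesis
      using \<rho>(1) by (simp add: L2_norm_def divide_right_mono)
  qed
  have "(\<phi> \<longlongrightarrow> 0) (at_right 0)"
    using S hI unfolding contraction_C0_semigroup_def \<phi>_def by blast
  \<comment> \<open>The punctured filter excludes s = t, so |s - t| tends to 0 through positive
    values.\<close>
  moreover have "filterlim (\<lambda>s. \<bar>s - t\<bar>) (at_right 0) (at t within {0..\<tau>})"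
    unfolding filterlim_at by (auto intro!: tendsto_eq_intros simp: eventually_at_filter)
  ultimately have "((\<lambda>s. \<phi> \<bar>s - t\<bar>) \<longlongrightarrow> 0) (at t within {0..\<tau>})"
    by (rule filterlim_compose)
  then have "((\<lambda>s. \<phi> \<bar>s - t\<bar> / sqrt m) \<longlongrightarrow> 0) (at t within {0..\<tau>})"
    using tendsto_divide[OF _ tendsto_const[of "sqrt m"]] \<rho>(1) by fastforce
  then show "((\<lambda>s. L2_norm \<Omega> (\<lambda>_. 1) (\<lambda>x. h s x - h t x)) \<longlongrightarrow> 0) (at t within {0..\<tau>})"
    by (rule Lim_null_comparison[rotated]) (use bound in \<open>auto simp: eventually_at_filter\<close>)
qed

lemma zero_in_L2_space: "(\<lambda>_. 0) \<in> L2_space \<Omega>"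
  by (simp add: L2_space_def)

text \<open>Compatibility with equality almost everywhere reduces to the zero function, and
  linearity with both coefficients 0 settles that case.\<close>

lemma semigroup_zero:
  fixes f :: "'a::euclidean_space \<Rightarrow> real"
  assumes S: "contraction_C0_semigroup \<Omega> \<rho> S" and "0 \<le> t"
    and f: "f \<in> L2_space \<Omega>" "eq_ae \<Omega> f (\<lambda>_. 0)"
  shows "eq_ae \<Omega> (S t f) (\<lambda>_. 0)"
proof -
  have cong: "\<And>g k. g \<in> L2_space \<Omega> \<Longrightarrow> k \<in> L2_space \<Omega> \<Longrightarrow> eq_ae \<Omega> g k \<Longrightarrow> eq_ae \<Omega> (S t g) (S t k)"
    and lin: "\<And>g k a b. g \<in> L2_space \<Omega> \<Longrightarrow> k \<in> L2_space \<Omega> \<Longrightarrow>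
        eq_ae \<Omega> (S t (\<lambda>x. a * g x + b * k x)) (\<lambda>x. a * S t g x + b * S t k x)"
    using S \<open>0 \<le> t\<close> by (auto simp: contraction_C0_semigroup_def)
  have "eq_ae \<Omega> (S t f) (S t (\<lambda>_. 0))"
    by (rule cong[OF f(1) zero_in_L2_space f(2)])
  moreover have "eq_ae \<Omega> (S t (\<lambda>_. 0)) (\<lambda>_. 0)"
    using lin[OF f(1) f(1), of 0 0] by simp
  ultimately show ?thesis
    unfolding eq_ae_def by eventually_elim simp
qed

text \<open>Evaluation at time 0, where the semigroup is the identity, gives one direction;
  linearity of S(t) gives the other.\<close>

lemma mild_solution_vanishes_iff:
  assumes S: "contraction_C0_semigroup \<Omega> \<rho> S" and hI: "h\<^sub>I \<in> L2_space \<Omega>" and "0 \<le> \<tau>"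
    and h: "mild_solution \<Omega> S \<tau> h\<^sub>I h"
  shows "vanishes_identically \<Omega> \<tau> h \<longleftrightarrow> eq_ae \<Omega> h\<^sub>I (\<lambda>_. 0)"
proof
  have "eq_ae \<Omega> (S 0 h\<^sub>I) h\<^sub>I"
    using S hI unfolding contraction_C0_semigroup_def by blast
  moreover have "eq_ae \<Omega> (h 0) (S 0 h\<^sub>I)"
    using h \<open>0 \<le> \<tau>\<close> by (simp add: mild_solution_def)
  moreover assume "vanishes_identically \<Omega> \<tau> h"
  then have "eq_ae \<Omega> (h 0) (\<lambda>_. 0)"
    using \<open>0 \<le> \<tau>\<close> by (simp add: vanishes_identically_def)
  ultimately show "eq_ae \<Omega> h\<^sub>I (\<lambda>_. 0)"
    unfolding eq_ae_def by eventually_elim simp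
next
  assume zero: "eq_ae \<Omega> h\<^sub>I (\<lambda>_. 0)"
  show "vanishes_identically \<Omega> \<tau> h"
    unfolding vanishes_identically_def
  proof
    fix t assume t: "t \<in> {0..\<tau>}"
    then have "eq_ae \<Omega> (h t) (S t h\<^sub>I)" using h by (simp add: mild_solution_def)
    moreover have "eq_ae \<Omega> (S t h\<^sub>I) (\<lambda>_. 0)"
      using semigroup_zero[OF S _ hI zero] t by simp
    ultimately show "eq_ae \<Omega> (h t) (\<lambda>_. 0)"
      unfolding eq_ae_def by eventually_elim simp
  qed
qed

text \<open>The difference of two weak divergences annihilates all test functions, so the
  fundamental lemma applies.\<close>

lemma weak_divergence_unique:
  fixes \<Omega> :: "'a::euclidean_space set"
  assumes "open \<Omega>" and "bounded \<Omega>" and q: "q\<^sub>1 \<in> L2_space \<Omega>" "q\<^sub>2 \<in> L2_space \<Omega>"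
    and "has_weak_divergence \<Omega> v q\<^sub>1" and "has_weak_divergence \<Omega> v q\<^sub>2"
  shows "eq_ae \<Omega> q\<^sub>1 q\<^sub>2"
proof -
  have d: "(\<lambda>x. q\<^sub>1 x - q\<^sub>2 x) \<in> L2_space \<Omega>"
    using L2_space_linear_combination[OF q, of 1 "-1"] by simp
  \<comment> \<open>Integrability of both products allows the integral of the difference to be
    split.\<close>
  have int: "integrable (lebesgue_on \<Omega>) (\<lambda>x. q x * \<psi> x)"
    if q: "q \<in> L2_space \<Omega>" and \<psi>: "test_function \<Omega> \<psi>" for q \<psi>
  proof -
    have cont: "continuous_on UNIV \<psi>"
      using \<psi> by (rule test_function_continuous)
    then have \<psi>m: "\<psi> \<in> borel_measurable borel"
      by (rule borel_measurable_continuous_onI)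
    obtain C where C: "\<And>x. \<bar>\<psi> x\<bar> \<le> C"
      by (rule continuous_compact_support_bounded[OF cont, of "closure {x. \<psi> x \<noteq> 0}"])
        (use \<psi> closure_subset[of "{x. \<psi> x \<noteq> 0}"] in \<open>auto simp: test_function_def\<close>)
    obtain g where g: "g \<in> borel_measurable borel"
      "AE x in lborel. g x = (if x \<in> \<Omega> then q x else 0)" "integrable lborel g"
      by (rule L2_space_borel_representative[OF assms(1,2) q])
    have "integrable lborel (\<lambda>x. C * g x)" using g(3) by simp
    then have "integrable lborel (\<lambda>x. g x * \<psi> x)"
    proof (rule Bochner_Integration.integrable_bound)
      have "\<bar>\<psi> x\<bar> \<le> \<bar>C\<bar>" for x using C[of x] by linarith
      then show "AE x in lborel. norm (g x * \<psi> x) \<le> norm (C * g x)"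
        by (simp add: abs_mult mult.commute[of "\<bar>C\<bar>"] mult_left_mono)
    qed (use g(1) \<psi>m in simp)
    moreover have "integrable (lebesgue_on \<Omega>) (\<lambda>x. q x * \<psi> x) \<longleftrightarrow> integrable lborel (\<lambda>x. g x * \<psi> x)"
    proof (rule integral_lebesgue_on_eq_lborel(2)[OF assms(1)])
      have "\<psi> \<in> borel_measurable (lebesgue_on \<Omega>)"
        using \<psi>m by (intro measurable_restrict_space1 measurable_completion) simp
      then show "(\<lambda>x. q x * \<psi> x) \<in> borel_measurable (lebesgue_on \<Omega>)"
        using q by (intro borel_measurable_times) (simp_all add: L2_space_def)
      show "AE x in lborel. g x * \<psi> x = (if x \<in> \<Omega> then q x * \<psi> x else 0)"
        using g(2) by eventually_elim auto
    qed (use g(1) \<psi>m in simp)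
    ultimately show ?thesis by simp
  qed
  have "eq_ae \<Omega> (\<lambda>x. q\<^sub>1 x - q\<^sub>2 x) (\<lambda>_. 0)"
  proof (rule fundamental_lemma_calculus_of_variations[OF assms(1,2) d])
    fix \<psi> assume \<psi>: "test_function \<Omega> \<psi>"
    then have "(LINT x|lebesgue_on \<Omega>. q\<^sub>1 x * \<psi> x) = (LINT x|lebesgue_on \<Omega>. q\<^sub>2 x * \<psi> x)"
      using assms(5,6) by (simp add: has_weak_divergence_def)
    then show "(LINT x|lebesgue_on \<Omega>. (q\<^sub>1 x - q\<^sub>2 x) * \<psi> x) = 0"
      using int[OF q(1) \<psi>] int[OF q(2) \<psi>] by (simp add: left_diff_distrib)
  qed
  then show ?thesis by (simp add: eq_ae_def)
qed


section \<open>The resonance quantity\<close>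

text \<open>Continuity on the compact closure makes the image bounded, so that the real infimum and
  supremum are genuine bounds; the infimum is positive by assumption.\<close>

lemma background_density_bounds:
  assumes "lipschitz_domain \<Omega>" and "background_flow \<Omega> u \<rho> p \<phi> c"
  obtains m M where "0 < m" and "\<And>x. x \<in> \<Omega> \<Longrightarrow> m \<le> \<rho> x \<and> \<rho> x \<le> M"
    and "\<rho> \<in> borel_measurable (lebesgue_on \<Omega>)"
proof -
  obtain L where "L-lipschitz_on (closure \<Omega>) \<rho>"
    using assms(2) by (auto simp: background_flow_def)
  then have cont: "continuous_on (closure \<Omega>) \<rho>"
    by (rule lipschitz_on_continuous_on)
  have "compact (closure \<Omega>)"
    using assms(1) by (simp add: lipschitz_domain_def compact_closure)
  with cont have bdd: "bounded (\<rho> ` closure \<Omega>)"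
    by (intro compact_imp_bounded compact_continuous_image)
  have "(INF x\<in>closure \<Omega>. \<rho> x) \<le> \<rho> x \<and> \<rho> x \<le> (SUP x\<in>closure \<Omega>. \<rho> x)" if "x \<in> \<Omega>" for x
    using that closure_subset[of \<Omega>] bounded_imp_bdd_below[OF bdd] bounded_imp_bdd_above[OF bdd]
    by (auto intro: cINF_lower cSUP_upper)
  moreover have "\<rho> \<in> borel_measurable (lebesgue_on \<Omega>)"
    using assms(1) continuous_on_subset[OF cont closure_subset]
    by (intro continuous_imp_measurable_on_sets_lebesgue) (auto simp: lipschitz_domain_def borel_open)
  ultimately show ?thesis
    using that assms(2) unfolding background_flow_def by blast
qed

lemma has_weak_divergence_cong_AE:
  assumes "eq_ae \<Omega> w w'" and "w \<in> L2_space \<Omega>" and "w' \<in> L2_space \<Omega>"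
    and \<rho>: "\<rho> \<in> borel_measurable (lebesgue_on \<Omega>)"
    and "has_weak_divergence \<Omega> (\<lambda>x. \<rho> x *\<^sub>R w x) q"
  shows "has_weak_divergence \<Omega> (\<lambda>x. \<rho> x *\<^sub>R w' x) q"
  unfolding has_weak_divergence_def
proof (intro allI impI)
  fix \<psi> :: "'a \<Rightarrow> real" assume \<psi>: "test_function \<Omega> \<psi>"
  have "grad \<psi> \<in> borel_measurable borel"
    unfolding grad_def
    by (intro borel_measurable_continuous_onI continuous_intros test_function_continuous_derivative[OF \<psi>])
  then have grad: "grad \<psi> \<in> borel_measurable (lebesgue_on \<Omega>)"
    by (intro measurable_restrict_space1 measurable_completion) simp
  have "(LINT x|lebesgue_on \<Omega>. (\<rho> x *\<^sub>R w x) \<bullet> grad \<psi> x) =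
      (LINT x|lebesgue_on \<Omega>. (\<rho> x *\<^sub>R w' x) \<bullet> grad \<psi> x)"
  proof (rule integral_cong_AE)
    show "AE x in lebesgue_on \<Omega>. (\<rho> x *\<^sub>R w x) \<bullet> grad \<psi> x = (\<rho> x *\<^sub>R w' x) \<bullet> grad \<psi> x"
      using assms(1) unfolding eq_ae_def by eventually_elim simp
  qed (use assms(2,3) \<rho> grad in \<open>auto simp: L2_space_def
      intro!: borel_measurable_inner borel_measurable_scaleR\<close>)
  with \<psi> assms(5) show "(LINT x|lebesgue_on \<Omega>. q x * \<psi> x) =
      - (LINT x|lebesgue_on \<Omega>. (\<rho> x *\<^sub>R w' x) \<bullet> grad \<psi> x)"
    by (simp add: has_weak_divergence_def)
qed

text \<open>Makes the quantity a function of the classes of density perturbation and displacement,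
  whichever witness \<open>q\<close> is chosen.\<close>

lemma resonance_quantity_unique_AE:
  assumes "open \<Omega>" and "bounded \<Omega>" and \<rho>: "\<rho> \<in> borel_measurable (lebesgue_on \<Omega>)"
    and r: "eq_ae \<Omega> r r'" and w: "eq_ae \<Omega> w w'" "w \<in> L2_space \<Omega>" "w' \<in> L2_space \<Omega>"
    and "resonance_quantity \<Omega> \<rho> r w h" and "resonance_quantity \<Omega> \<rho> r' w' h'"
  shows "eq_ae \<Omega> h h'"
proof -
  obtain q q' where q: "q \<in> L2_space \<Omega>" "has_weak_divergence \<Omega> (\<lambda>x. \<rho> x *\<^sub>R w x) q"
      "eq_ae \<Omega> h (\<lambda>x. inverse (\<rho> x) * (r x + q x))"
    and q': "q' \<in> L2_space \<Omega>" "has_weak_divergence \<Omega> (\<lambda>x. \<rho> x *\<^sub>R w' x) q'"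
      "eq_ae \<Omega> h' (\<lambda>x. inverse (\<rho> x) * (r' x + q' x))"
    using assms(8,9) unfolding resonance_quantity_def by blast
  have "eq_ae \<Omega> q q'"
    using weak_divergence_unique[OF assms(1,2) q(1) q'(1) has_weak_divergence_cong_AE[OF w \<rho> q(2)] q'(2)] .
  with r q(3) q'(3) show ?thesis
    unfolding eq_ae_def by eventually_elim simp
qed

theorem mainTheorem5:
  fixes \<Omega> :: "'a::euclidean_space set"
    and u\<^sub>0 \<phi>\<^sub>0 :: "'a \<Rightarrow> 'a"
    and \<rho>\<^sub>0 p\<^sub>0 c\<^sub>0 :: "'a \<Rightarrow> real"
    and \<tau> :: real
  assumes "lipschitz_domain \<Omega>"
    and "0 < \<tau>"
    and "background_flow \<Omega> u\<^sub>0 \<rho>\<^sub>0 p\<^sub>0 \<phi>\<^sub>0 c\<^sub>0"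
    and "tangential \<Omega> u\<^sub>0"
  shows "(\<forall>r\<^sub>I\<in>L2_space \<Omega>. \<exists>w\<^sub>I\<in>L2_space \<Omega>.
            has_weak_divergence \<Omega> (\<lambda>x. \<rho>\<^sub>0 x *\<^sub>R w\<^sub>I x) (\<lambda>x. - r\<^sub>I x) \<and>
            resonance_quantity \<Omega> \<rho>\<^sub>0 r\<^sub>I w\<^sub>I (\<lambda>_. 0)) \<and>
         (\<forall>S. transport_semigroup \<Omega> u\<^sub>0 \<rho>\<^sub>0 S \<longrightarrow>
            (\<forall>h\<^sub>I\<in>L2_space \<Omega>.
               (\<exists>h. mild_solution \<Omega> S \<tau> h\<^sub>I h) \<and>
               (\<forall>h. mild_solution \<Omega> S \<tau> h\<^sub>I h \<longrightarrow>
                  continuous_L2 \<Omega> \<tau> h \<and>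
                  (vanishes_identically \<Omega> \<tau> h \<longleftrightarrow> eq_ae \<Omega> h\<^sub>I (\<lambda>_. 0))))) \<and>
         (\<forall>r\<^sub>I\<in>L2_space \<Omega>. \<exists>w\<^sub>I\<in>L2_space \<Omega>.
            resonance_quantity \<Omega> \<rho>\<^sub>0 r\<^sub>I w\<^sub>I (\<lambda>_. 0) \<and>
            (\<forall>S r w h.
               transport_semigroup \<Omega> u\<^sub>0 \<rho>\<^sub>0 S \<and>
               (\<forall>t\<in>{0..\<tau>}. r t \<in> L2_space \<Omega> \<and> w t \<in> L2_space \<Omega> \<and>
                  resonance_quantity \<Omega> \<rho>\<^sub>0 (r t) (w t) (h t)) \<and>
               eq_ae \<Omega> (r 0) r\<^sub>I \<and> eq_ae \<Omega> (w 0) w\<^sub>I \<longrightarrow>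
               no_resonance \<Omega> S \<tau> h))"
proof (intro conjI)
  have \<Omega>: "open \<Omega>" "bounded \<Omega>" using assms(1) by (auto simp: lipschitz_domain_def)
  obtain m M where \<rho>: "0 < m" "\<And>x. x \<in> \<Omega> \<Longrightarrow> m \<le> \<rho>\<^sub>0 x \<and> \<rho>\<^sub>0 x \<le> M"
    and \<rho>m: "\<rho>\<^sub>0 \<in> borel_measurable (lebesgue_on \<Omega>)"
    by (rule background_density_bounds[OF assms(1,3)]) blast
  have displacement: "\<exists>w\<^sub>I\<in>L2_space \<Omega>.
      has_weak_divergence \<Omega> (\<lambda>x. \<rho>\<^sub>0 x *\<^sub>R w\<^sub>I x) (\<lambda>x. - r\<^sub>I x) \<and>
      resonance_quantity \<Omega> \<rho>\<^sub>0 r\<^sub>I w\<^sub>I (\<lambda>_. 0)" if "r\<^sub>I \<in> L2_space \<Omega>" for r\<^sub>I :: "'a \<Rightarrow> real"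
  proof -
    have "(\<lambda>x. - r\<^sub>I x) \<in> L2_space \<Omega>"
      using that by (simp add: L2_space_def)
    \<comment> \<open>The weak divergence prescribed here is the negative of the density datum, so
      the two terms of the resonance quantity cancel.\<close>
    with ex_weighted_weak_divergence[OF \<Omega> this \<rho>m \<rho>(1)] \<rho>(2) show ?thesis
      unfolding resonance_quantity_def eq_ae_def by fastforce
  qed
  then show "\<forall>r\<^sub>I\<in>L2_space \<Omega>. \<exists>w\<^sub>I\<in>L2_space \<Omega>.
      has_weak_divergence \<Omega> (\<lambda>x. \<rho>\<^sub>0 x *\<^sub>R w\<^sub>I x) (\<lambda>x. - r\<^sub>I x) \<and>
      resonance_quantity \<Omega> \<rho>\<^sub>0 r\<^sub>I w\<^sub>I (\<lambda>_. 0)" by blast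
  show "\<forall>S. transport_semigroup \<Omega> u\<^sub>0 \<rho>\<^sub>0 S \<longrightarrow>
      (\<forall>h\<^sub>I\<in>L2_space \<Omega>.
         (\<exists>h. mild_solution \<Omega> S \<tau> h\<^sub>I h) \<and>
         (\<forall>h. mild_solution \<Omega> S \<tau> h\<^sub>I h \<longrightarrow>
            continuous_L2 \<Omega> \<tau> h \<and>
            (vanishes_identically \<Omega> \<tau> h \<longleftrightarrow> eq_ae \<Omega> h\<^sub>I (\<lambda>_. 0))))"
  proof (intro allI impI ballI conjI)
    fix S and h\<^sub>I :: "'a \<Rightarrow> real" assume S: "transport_semigroup \<Omega> u\<^sub>0 \<rho>\<^sub>0 S" and hI: "h\<^sub>I \<in> L2_space \<Omega>"
    then have C0: "contraction_C0_semigroup \<Omega> \<rho>\<^sub>0 S" by (simp add: transport_semigroup_def)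
    have "mild_solution \<Omega> S \<tau> h\<^sub>I (\<lambda>t. S t h\<^sub>I)"
      using C0 hI by (simp add: mild_solution_def contraction_C0_semigroup_def eq_ae_def)
    then show "\<exists>h. mild_solution \<Omega> S \<tau> h\<^sub>I h" by blast
    fix h assume h: "mild_solution \<Omega> S \<tau> h\<^sub>I h"
    show "continuous_L2 \<Omega> \<tau> h"
      by (rule mild_solution_continuous_L2[OF C0 hI \<rho>m \<rho> h])
    show "vanishes_identically \<Omega> \<tau> h \<longleftrightarrow> eq_ae \<Omega> h\<^sub>I (\<lambda>_. 0)"
      using mild_solution_vanishes_iff[OF C0 hI _ h] assms(2) by simp
  qed
  show "\<forall>r\<^sub>I\<in>L2_space \<Omega>. \<exists>w\<^sub>I\<in>L2_space \<Omega>.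
      resonance_quantity \<Omega> \<rho>\<^sub>0 r\<^sub>I w\<^sub>I (\<lambda>_. 0) \<and>
      (\<forall>S r w h.
         transport_semigroup \<Omega> u\<^sub>0 \<rho>\<^sub>0 S \<and>
         (\<forall>t\<in>{0..\<tau>}. r t \<in> L2_space \<Omega> \<and> w t \<in> L2_space \<Omega> \<and>
            resonance_quantity \<Omega> \<rho>\<^sub>0 (r t) (w t) (h t)) \<and>
         eq_ae \<Omega> (r 0) r\<^sub>I \<and> eq_ae \<Omega> (w 0) w\<^sub>I \<longrightarrow>
         no_resonance \<Omega> S \<tau> h)"
  proof
    fix r\<^sub>I :: "'a \<Rightarrow> real" assume "r\<^sub>I \<in> L2_space \<Omega>"
    with displacement obtain w\<^sub>I where wI: "w\<^sub>I \<in> L2_space \<Omega>" "resonance_quantity \<Omega> \<rho>\<^sub>0 r\<^sub>I w\<^sub>I (\<lambda>_. 0)"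
      by blast
    have "no_resonance \<Omega> S \<tau> h"
      if S: "transport_semigroup \<Omega> u\<^sub>0 \<rho>\<^sub>0 S"
        and rw: "\<forall>t\<in>{0..\<tau>}. r t \<in> L2_space \<Omega> \<and> w t \<in> L2_space \<Omega> \<and>
            resonance_quantity \<Omega> \<rho>\<^sub>0 (r t) (w t) (h t)"
        and init: "eq_ae \<Omega> (r 0) r\<^sub>I" "eq_ae \<Omega> (w 0) w\<^sub>I"
      for S and r :: "real \<Rightarrow> 'a \<Rightarrow> real" and w h
      unfolding no_resonance_def
    proof
      assume h: "mild_solution \<Omega> S \<tau> (h 0) h"
      have 0: "0 \<in> {0..\<tau>}" using assms(2) by simp
      \<comment> \<open>Both \<open>h 0\<close> and 0 are resonance quantities of data that agree
        almost everywhere: 0 by the choice of \<open>w\<^sub>I\<close>, \<open>h 0\<close> by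
        evaluation at time 0.\<close>
      have "eq_ae \<Omega> (h 0) (\<lambda>_. 0)"
        using resonance_quantity_unique_AE[OF \<Omega> \<rho>m init(1) init(2) _ wI(1) _ wI(2)] rw 0 by blast
      moreover have "contraction_C0_semigroup \<Omega> \<rho>\<^sub>0 S" "h 0 \<in> L2_space \<Omega>"
        using S h 0 by (simp_all add: transport_semigroup_def mild_solution_def)
      ultimately show "vanishes_identically \<Omega> \<tau> h"
        using mild_solution_vanishes_iff h assms(2) by (metis less_imp_le)
    qed
    with wI show "\<exists>w\<^sub>I\<in>L2_space \<Omega>.
      resonance_quantity \<Omega> \<rho>\<^sub>0 r\<^sub>I w\<^sub>I (\<lambda>_. 0) \<and>
      (\<forall>S r w h.
         transport_semigroup \<Omega> u\<^sub>0 \<rho>\<^sub>0 S \<and>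
         (\<forall>t\<in>{0..\<tau>}. r t \<in> L2_space \<Omega> \<and> w t \<in> L2_space \<Omega> \<and>
            resonance_quantity \<Omega> \<rho>\<^sub>0 (r t) (w t) (h t)) \<and>
         eq_ae \<Omega> (r 0) r\<^sub>I \<and> eq_ae \<Omega> (w 0) w\<^sub>I \<longrightarrow>
         no_resonance \<Omega> S \<tau> h)" by blast
  qed
qed

end
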